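(* Let $W$ be a $1|2$-dimensional $\mathbb{Z}_2$-graded vector space over $\mathfrak K$, let $m\ge0$ be an integer, and let $d_\infty=\psi^{1,1,m}_1\in L_{m+2}$. For each integer $n>m$ and each $a\in\mathfrak K$, $$d_{\infty,n,a}=\psi^{1,1,m}_1+\psi^{0,1,n+1}_3+\psi^{0,1,2n-m+1}_3a$$ is an extension of $d_\infty$. Every extension of $d_\infty$ is equivalent either to $d_\infty$ or to $d_{\infty,n,a}$ for some integer $n>m$ and some $a\in\mathfrak K$, and the codifferentials $d_\infty$ and $d_{\infty,n,a}$ ($n>m$, $a\in\mathfrak K$) are pairwise nonequivalent.
   Context: $\mathfrak K$ is an algebraically closed field of characteristic zero. $W=\langle w_1,w_2,w_3\rangle$ is the $\mathbb{Z}_2$-graded vector space with $w_1,w_2$ odd and $w_3$ even. $S(W)=\bigoplus_{n\ge1}S^n(W)$ is the reduced $\mathbb{Z}_2$-graded symmetric algebra (with $uv=(-1)^{uv}vu$), with its coalgebra structure $\Delta(v_1\cdots v_n)=\sum_{k=1}^{n-1}\sum_{\sigma\in \mathrm{Sh}(k,n-k)}\epsilon(\sigma)\,v_{\sigma(1)}\cdots v_{\sigma(k)}\otimes v_{\sigma(k+1)}\cdots v_{\sigma(n)}$, where $\mathrm{Sh}(k,n-k)$ is the set of unshuffles and $\epsilon(\sigma)$ is the sign with $v_{\sigma(1)}\cdots v_{\sigma(n)}=\epsilon(\sigma)v_1\cdots v_n$. Put $L_n=\mathrm{Hom}(S^n(W),W)$ and $L=\mathrm{Hom}(S(W),W)=\prod_{n\ge1}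 L_n$. Each $\varphi\in L_k$ extends to a coderivation $\tilde\varphi$ of $S(W)$ by $\tilde\varphi(v_1\cdots v_n)=\sum_{\sigma\in\mathrm{Sh}(k,n-k)}\epsilon(\sigma)\varphi(v_{\sigma(1)}\cdots v_{\sigma(k)})v_{\sigma(k+1)}\cdots v_{\sigma(n)}$, and this identifies $L$ with the coderivations of $S(W)$. The bracket on $L$ is $[\alpha,\beta]=\alpha\tilde\beta-(-1)^{\alpha\beta}\beta\tilde\alpha$. A codifferential (an $L_\infty$ structure on $W$, in the parity-reversed convention) is an odd element $d\in L$ with $[d,d]=0$, equivalently $\tilde d^2=0$. Two codifferentials $d,d'$ are equivalent if there is a parity-preserving coalgebra automorphism $\tilde g$ of $S(W)$ (determined by $g=g_1+g_2+\cdots\in L$, $g_i:S^i(W)\to W$ even, $g_1$ invertible) with $d'=\tilde g^{-1}\circ d\circ\tilde g$. An extension of a codifferential $d_N\in L_N$ is a codifferential $d=d_N+d_{N+1}+\cdots$ with $d_i\in L_i$, whose lowest-degree term is $d_N$ (so $d_N$ is itself an extension of $d_N$). For $I=(i_1,i_2,i_3)$ with $i_1,i_2\in\{0,1\}$, $i_3\ge0$ and $|I|=i_1+i_2+i_3\ge1$, let $w_I=w_1^{i_1}w_2^{i_2}w_3^{i_3}$ and $I!=i_1!i_2!i_3!$. The element $\varphi^I_j\in L_{|I|}$ is defined by $\varphi^I_j(w_J)=I!\,\delta^I_J\,w_j$. It is written $\psi^I_j$ when it is odd. *)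

theory Defs
  imports
    "HOL-Library.Poly_Mapping"
    "HOL-Library.Z2"
    "HOL-Combinatorics.Permutations"
    "HOL-Computational_Algebra.Polynomial"
begin

section \<open>Free vector spaces on a graded basis\<close>

text \<open>
  The type of finitely supported functions \<open>'b \<Rightarrow>\<^sub>0 'k\<close> serves as the
  \<open>'k\<close>-vector space with basis \<open>'b\<close>; the basis vectors are \<open>vec b\<close>.
\<close>

definition vscale :: "'k::field \<Rightarrow> ('b \<Rightarrow>\<^sub>0 'k) \<Rightarrow> ('b \<Rightarrow>\<^sub>0 'k)"  (infixr \<open>*\<^sub>v\<close> 75)
  where "c *\<^sub>v x = Poly_Mapping.map ((*) c) x"

abbreviation vec :: "'b \<Rightarrow> ('b \<Rightarrow>\<^sub>0 'k::field)"
  where "vec b \<equiv> Poly_Mapping.single b 1"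

lemma lookup_vscale [simp]: "Poly_Mapping.lookup (c *\<^sub>v x) b = c * Poly_Mapping.lookup x b"
  unfolding vscale_def by transfer (simp add: when_def)

lemma vector_space_vscale: "vector_space (vscale :: 'k::field \<Rightarrow> ('b \<Rightarrow>\<^sub>0 'k) \<Rightarrow> _)"
  by standard (auto intro!: poly_mapping_eqI simp: lookup_add algebra_simps)

abbreviation lin :: "(('b \<Rightarrow>\<^sub>0 'k::field) \<Rightarrow> ('c \<Rightarrow>\<^sub>0 'k)) \<Rightarrow> bool"
  where "lin \<equiv> Vector_Spaces.linear vscale vscale"

text \<open>The linear map with prescribed values on the basis.\<close>

definition lin_ext :: "('b \<Rightarrow> ('c \<Rightarrow>\<^sub>0 'k::field)) \<Rightarrow> ('b \<Rightarrow>\<^sub>0 'k) \<Rightarrow> ('c \<Rightarrow>\<^sub>0 'k)"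
  where "lin_ext f x = (\<Sum>b\<in>Poly_Mapping.keys x. Poly_Mapping.lookup x b *\<^sub>v f b)"

text \<open>
  A grading is given by a function \<open>gr\<close> on the basis; \<open>proj gr p\<close> is the projection
  onto the homogeneous component of degree \<open>p\<close>.
\<close>

definition proj :: "('b \<Rightarrow> 'g) \<Rightarrow> 'g \<Rightarrow> ('b \<Rightarrow>\<^sub>0 'k::field) \<Rightarrow> ('b \<Rightarrow>\<^sub>0 'k)"
  where "proj gr p = lin_ext (\<lambda>b. if gr b = p then vec b else 0)"

definition has_parity ::
    "('b \<Rightarrow> bit) \<Rightarrow> ('c \<Rightarrow> bit) \<Rightarrow> bit \<Rightarrow> (('b \<Rightarrow>\<^sub>0 'k::field) \<Rightarrow> ('c \<Rightarrow>\<^sub>0 'k)) \<Rightarrow> bool"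
  where "has_parity gr gr' p f \<longleftrightarrow>
    (\<forall>q x. (\<forall>b\<in>Poly_Mapping.keys x. gr b = q) \<longrightarrow> (\<forall>c\<in>Poly_Mapping.keys (f x). gr' c = p + q))"

definition tensor :: "('b \<Rightarrow>\<^sub>0 'k::field) \<Rightarrow> ('c \<Rightarrow>\<^sub>0 'k) \<Rightarrow> ('b \<times> 'c \<Rightarrow>\<^sub>0 'k)"
  where "tensor x y = lin_ext (\<lambda>b. lin_ext (\<lambda>c. vec (b, c)) y) x"

text \<open>The map \<open>f \<otimes> g\<close>; no Koszul sign occurs when \<open>g\<close> is even, the only case used below.\<close>

definition tensor_map ::
    "(('b \<Rightarrow>\<^sub>0 'k::field) \<Rightarrow> ('c \<Rightarrow>\<^sub>0 'k)) \<Rightarrow> (('b' \<Rightarrow>\<^sub>0 'k) \<Rightarrow> ('c' \<Rightarrow>\<^sub>0 'k)) \<Rightarrow>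
      ('b \<times> 'b' \<Rightarrow>\<^sub>0 'k) \<Rightarrow> ('c \<times> 'c' \<Rightarrow>\<^sub>0 'k)"
  where "tensor_map f g = lin_ext (\<lambda>(b, b'). tensor (f (vec b)) (g (vec b')))"

text \<open>The sign \<open>(-1)\<^sup>p\<^sup>q\<close>.\<close>

definition ksign :: "bit \<Rightarrow> bit \<Rightarrow> 'k::field"
  where "ksign p q = (if p = 1 \<and> q = 1 then - 1 else 1)"


section \<open>The space \<open>W\<close> and its reduced graded symmetric algebra\<close>

datatype gvar = W1 | W2 | W3

fun gpar :: "gvar \<Rightarrow> bit" where
  "gpar W1 = 1"
| "gpar W2 = 1"
| "gpar W3 = 0"

type_synonym 'k W = "gvar \<Rightarrow>\<^sub>0 'k"

text \<open>The exponents \<open>I\<close> of the monomials \<open>w\<^sub>I\<close>, which form a basis of \<open>S(W)\<close>.\<close>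

typedef mindex = "{(i1::nat, i2::nat, i3::nat). i1 \<le> 1 \<and> i2 \<le> 1 \<and> i1 + i2 + i3 \<ge> 1}"
  morphisms exps MI
  by (rule exI [of _ "(0, 0, 1)"]) simp

type_synonym 'k S = "mindex \<Rightarrow>\<^sub>0 'k"

definition mdeg :: "mindex \<Rightarrow> nat"
  where "mdeg I = (case exps I of (i1, i2, i3) \<Rightarrow> i1 + i2 + i3)"

definition mpar :: "mindex \<Rightarrow> bit"
  where "mpar I = (case exps I of (i1, i2, i3) \<Rightarrow> of_nat (i1 + i2))"

definition mfact :: "mindex \<Rightarrow> nat"
  where "mfact I = (case exps I of (i1, i2, i3) \<Rightarrow> fact i1 * fact i2 * fact i3)"

definition mword :: "mindex \<Rightarrow> gvar list"
  where "mword I = (case exps I of (i1, i2, i3) \<Rightarrow>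
    replicate i1 W1 @ replicate i2 W2 @ replicate i3 W3)"

fun gmono :: "gvar \<Rightarrow> mindex" where
  "gmono W1 = MI (1, 0, 0)"
| "gmono W2 = MI (0, 1, 0)"
| "gmono W3 = MI (0, 0, 1)"

text \<open>The product \<open>w\<^sub>j w\<^sub>I\<close> in \<open>S(W)\<close>.\<close>

fun lmul :: "gvar \<Rightarrow> mindex \<Rightarrow> 'k::field S" where
  "lmul W1 I = (case exps I of (i1, i2, i3) \<Rightarrow>
      if i1 = 0 then vec (MI (1, i2, i3)) else 0)"
| "lmul W2 I = (case exps I of (i1, i2, i3) \<Rightarrow>
      if i2 = 0 then (- 1) ^ i1 *\<^sub>v vec (MI (i1, 1, i3)) else 0)"
| "lmul W3 I = (case exps I of (i1, i2, i3) \<Rightarrow> vec (MI (i1, i2, Suc i3)))"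

text \<open>
  The product in \<open>S(W)\<close> of the letters of a nonempty word (\<open>S(W)\<close> has no unit, so the
  value at the empty word is a dummy).
\<close>

fun wprod :: "gvar list \<Rightarrow> 'k::field S" where
  "wprod [] = 0"
| "wprod [x] = vec (gmono x)"
| "wprod (x # y # u) = lin_ext (lmul x) (wprod (y # u))"

text \<open>The product \<open>x u\<close> of \<open>x \<in> W\<close> with a possibly empty word \<open>u\<close>.\<close>

definition wmul :: "'k::field W \<Rightarrow> gvar list \<Rightarrow> 'k S"
  where "wmul x u = lin_ext (\<lambda>j. wprod (j # u)) x"


section \<open>Coalgebra structure and coderivations\<close>

text \<open>
  Positions in a word are counted from \<open>0\<close>.  The arguments of \<open>unshuffles\<close> are \<open>k\<close> and
  the total length \<open>n\<close>.
\<close>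

definition unshuffles :: "nat \<Rightarrow> nat \<Rightarrow> (nat \<Rightarrow> nat) set"
  where "unshuffles k n =
    {\<sigma>. \<sigma> permutes {..<n} \<and> strict_mono_on {..<k} \<sigma> \<and> strict_mono_on {k..<n} \<sigma>}"

definition koszul :: "gvar list \<Rightarrow> (nat \<Rightarrow> nat) \<Rightarrow> 'k::field"
  where "koszul u \<sigma> =
    (\<Prod>(i, j)\<in>{(i, j). i < j \<and> j < length u \<and> \<sigma> i > \<sigma> j}. ksign (gpar (u ! \<sigma> i)) (gpar (u ! \<sigma> j)))"

definition subword :: "gvar list \<Rightarrow> (nat \<Rightarrow> nat) \<Rightarrow> nat \<Rightarrow> nat \<Rightarrow> gvar list"
  where "subword u \<sigma> a b = map (\<lambda>i. u ! \<sigma> i) [a..<b]"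

definition comult_word :: "gvar list \<Rightarrow> (mindex \<times> mindex) \<Rightarrow>\<^sub>0 'k::field"
  where "comult_word u = (let n = length u in
    \<Sum>k = 1..<n. \<Sum>\<sigma>\<in>unshuffles k n.
      koszul u \<sigma> *\<^sub>v tensor (wprod (subword u \<sigma> 0 k)) (wprod (subword u \<sigma> k n)))"

definition comult :: "'k::field S \<Rightarrow> ((mindex \<times> mindex) \<Rightarrow>\<^sub>0 'k)"
  where "comult = lin_ext (\<lambda>I. comult_word (mword I))"

type_synonym 'k L = "'k S \<Rightarrow> 'k W"

text \<open>
  \<open>coder \<phi>\<close> is the coderivation extending \<open>\<phi> \<in> L\<close>; the summand with index \<open>k\<close> is the
  contribution of the component of \<open>\<phi>\<close> in \<open>L\<^sub>k\<close>.
\<close>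

definition coder_word :: "'k::field L \<Rightarrow> gvar list \<Rightarrow> 'k S"
  where "coder_word \<phi> u = (let n = length u in
    \<Sum>k = 1..n. \<Sum>\<sigma>\<in>unshuffles k n.
      koszul u \<sigma> *\<^sub>v wmul (\<phi> (wprod (subword u \<sigma> 0 k))) (subword u \<sigma> k n))"

definition coder :: "'k::field L \<Rightarrow> 'k S \<Rightarrow> 'k S"
  where "coder \<phi> = lin_ext (\<lambda>I. coder_word \<phi> (mword I))"

definition par_comp :: "bit \<Rightarrow> 'k::field L \<Rightarrow> 'k L"
  where "par_comp p \<phi> x = (\<Sum>q\<in>{0, 1}. proj gpar (p + q) (\<phi> (proj mpar q x)))"

definition deg_comp :: "nat \<Rightarrow> 'k::field L \<Rightarrow> 'k L"
  where "deg_comp n \<phi> x = \<phi> (proj mdeg n x)"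

text \<open>
  The bracket is given on homogeneous elements by
  \<open>[\<alpha>, \<beta>] = \<alpha> \<circ> coder \<beta> - (-1)\<^sup>\<alpha>\<^sup>\<beta> \<beta> \<circ> coder \<alpha>\<close>, and in general by bilinearity.
\<close>

definition bracket :: "'k::field L \<Rightarrow> 'k L \<Rightarrow> 'k L"
  where "bracket \<alpha> \<beta> x = \<alpha> (coder \<beta> x)
    - (\<Sum>p\<in>{0, 1}. \<Sum>q\<in>{0, 1}. ksign p q *\<^sub>v par_comp q \<beta> (coder (par_comp p \<alpha>) x))"

definition codifferential :: "'k::field L \<Rightarrow> bool"
  where "codifferential d \<longleftrightarrow> lin d \<and> has_parity mpar gpar 1 d \<and> bracket d d = (\<lambda>x. 0)"

definition coalg_automorphism :: "('k::field S \<Rightarrow> 'k S) \<Rightarrow> bool"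
  where "coalg_automorphism g \<longleftrightarrow> lin g \<and> bij g \<and> has_parity mpar mpar 0 g \<and>
    (\<forall>x. comult (g x) = tensor_map g g (comult x))"

definition equivalent :: "'k::field L \<Rightarrow> 'k L \<Rightarrow> bool"
  where "equivalent d d' \<longleftrightarrow>
    (\<exists>g. coalg_automorphism g \<and> coder d' = Hilbert_Choice.inv g \<circ> coder d \<circ> g)"

text \<open>\<open>is_extension N dN d\<close>: \<open>d\<close> is an extension of the codifferential \<open>dN \<in> L\<^sub>N\<close>.\<close>

definition is_extension :: "nat \<Rightarrow> 'k::field L \<Rightarrow> 'k L \<Rightarrow> bool"
  where "is_extension N dN d \<longleftrightarrow>
    codifferential dN \<and> deg_comp N dN = dN \<and> codifferential d \<and>
    (\<forall>k<N. deg_comp k d = (\<lambda>x. 0)) \<and> deg_comp N d = dN"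


section \<open>The codifferentials of the classification\<close>

definition phi :: "nat \<times> nat \<times> nat \<Rightarrow> gvar \<Rightarrow> 'k::field L"
  where "phi I j = lin_ext (\<lambda>J. if J = MI I then of_nat (mfact J) *\<^sub>v vec j else 0)"

definition d_inf :: "nat \<Rightarrow> 'k::field L"
  where "d_inf m = phi (1, 1, m) W1"

text \<open>Used for \<open>n > m\<close> only, where the subtraction does not truncate.\<close>

definition d_fam :: "nat \<Rightarrow> nat \<Rightarrow> 'k::field \<Rightarrow> 'k L"
  where "d_fam m n a x =
    phi (1, 1, m) W1 x + phi (0, 1, n + 1) W3 x + a *\<^sub>v phi (0, 1, 2 * n - m + 1) W3 x"

end

(*
  In the dual picture S(W)* is the maximal ideal of the algebra of superfunctions in an even
  variable x and odd variables t1, t2, a coalgebra automorphism is a formal coordinate change, and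
  a codifferential is an odd vector field Q vanishing at the origin with Q^2 = 0.  Comparing orders
  of vanishing in Q^2 = 0, an extension of t1 t2 x^m d/dt1 becomes, after replacing t2 by a
  combination of t1 and t2, a field A(x) t1 t2 d/dt1 + B(x) t2 d/dx with A of order m.  For B = 0,
  rescaling t2 gives the codifferential d_inf.  Otherwise rescaling t2 changes only the common
  factor of A and B, and rescaling t1 by a unit v(x) changes the form (A/B) dx by the holomorphic
  form dv/v.  Hence the only invariants are the pole order n - m + 1 and the residue - a of this
  form, and Z^(-p-1) (1 + a Z^p)^(-1) dZ with p = n - m is a representative.
*)

theory Submission
  imports Defs "HOL-Computational_Algebra.Formal_Power_Series"
begin

section \<open>Pairing with functionals\<close>

text \<open>Elements of \<open>S(W)\<close> have finite support, so functionals on it are arbitrary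
  functions on monomials, that is, power series; identities in \<open>S(W)\<close> are tested
  against all of them. The two halves of the classification meet automorphisms differently.
  Existence needs only the substitutions \<open>sf_subst\<close>, which transpose to
  \<open>S(W)\<close> because they do not lower orders of vanishing. Nonequivalence starts from an
  arbitrary coalgebra automorphism, which is not identified with a substitution: its transpose is
  only known to be linear, parity preserving and multiplicative on functions without constant term.
  This suffices because the fields to be compared have polynomial coefficients. The exponent
  \<open>2 * n - m + 1\<close> is \<open>(n + 1) + p\<close>, which puts the factor 1 + a Z^p into
  the representative. The principal part without its residue term has a primitive, and the
  coordinate Z with Z^(-p) equal to -p times this primitive needs a p-th root: here algebraic
  closedness enters. Removing the holomorphic remainder needs the exponential of a
  primitive.\<close>

definition ev :: "('b \<Rightarrow> 'k::field) \<Rightarrow> ('b \<Rightarrow>\<^sub>0 'k) \<Rightarrow> 'k"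
  where "ev c x = (\<Sum>b\<in>Poly_Mapping.keys x. Poly_Mapping.lookup x b * c b)"

lemma ev_superset:
  assumes "finite A" "Poly_Mapping.keys x \<subseteq> A"
  shows "ev c x = (\<Sum>b\<in>A. Poly_Mapping.lookup x b * c b)"
  unfolding ev_def using assms by (intro sum.mono_neutral_left) (auto simp: in_keys_iff)

lemma ev_0 [simp]: "ev c 0 = 0"
  by (simp add: ev_def)

lemma ev_zero_functional [simp]: "ev (\<lambda>_. 0) x = 0"
  by (simp add: ev_def)

lemma ev_add [simp]: "ev c (x + y) = ev c x + ev c y"
proof -
  let ?A = "Poly_Mapping.keys x \<union> Poly_Mapping.keys y"
  have "Poly_Mapping.keys (x + y) \<subseteq> ?A" by (rule keys_add)
  then show ?thesis
    by (simp add: ev_superset [of ?A] lookup_add algebra_simps sum.distrib)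
qed

lemma ev_vscale [simp]: "ev c (r *\<^sub>v x) = r * ev c x"
proof -
  have "Poly_Mapping.keys (r *\<^sub>v x) \<subseteq> Poly_Mapping.keys x" by (auto simp: in_keys_iff)
  then show ?thesis
    by (simp add: ev_superset [of "Poly_Mapping.keys x"] sum_distrib_left algebra_simps)
qed

lemma ev_sum: "ev c (\<Sum>i\<in>A. f i) = (\<Sum>i\<in>A. ev c (f i))"
  by (induction A rule: infinite_finite_induct) auto

lemma ev_single [simp]: "ev c (Poly_Mapping.single b r) = r * c b"
  by (cases "r = 0") (simp_all add: ev_def)

lemma ev_lin_ext [simp]: "ev c (lin_ext f x) = ev (\<lambda>b. ev c (f b)) x"
  by (simp add: lin_ext_def ev_sum) (simp add: ev_def)

lemma lookup_eq_ev: "Poly_Mapping.lookup x b = ev (\<lambda>b'. if b' = b then 1 else 0) x"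
proof -
  have "ev (\<lambda>b'. if b' = b then 1 else 0) x
      = (\<Sum>b'\<in>Poly_Mapping.keys x. if b = b' then Poly_Mapping.lookup x b else 0)"
    unfolding ev_def by (intro sum.cong) auto
  then show ?thesis by (simp add: sum.delta in_keys_iff)
qed

lemma ev_eqI: "(\<And>c. ev c x = ev c y) \<Longrightarrow> x = y"
  by (intro poly_mapping_eqI) (simp add: lookup_eq_ev)

lemma ev_gvar: "ev c x = (\<Sum>j\<in>{W1, W2, W3}. Poly_Mapping.lookup x j * c j)"
proof (rule ev_superset)
  show "Poly_Mapping.keys x \<subseteq> {W1, W2, W3}"
  proof
    fix j show "j \<in> {W1, W2, W3}" by (cases j) auto
  qed
qed simp

lemma ev_functional_mult [simp]:
  "ev (\<lambda>b. r * c b) x = r * ev c x" "ev (\<lambda>b. c b * r) x = ev c x * r"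
  unfolding ev_def by (simp_all add: sum_distrib_left sum_distrib_right algebra_simps)

lemma ev_functional_add: "ev (\<lambda>b. c b + c' b) x = ev c x + ev c' x"
  unfolding ev_def by (simp add: sum.distrib algebra_simps)

lemma lin_iff: "lin f \<longleftrightarrow> (\<forall>x y. f (x + y) = f x + f y) \<and> (\<forall>r x. f (r *\<^sub>v x) = r *\<^sub>v f x)"
  unfolding Vector_Spaces.linear_iff by (auto simp: vector_space_vscale)

lemma lin_lin_ext: "lin (lin_ext f)"
  unfolding lin_iff by (auto intro!: ev_eqI)

lemma vscale_zero [simp]: "0 *\<^sub>v x = 0"
  by (rule poly_mapping_eqI) simp

lemma vscale_zero_right [simp]: "r *\<^sub>v 0 = 0"
  by (rule poly_mapping_eqI) simp

lemma vscale_one [simp]: "1 *\<^sub>v x = x"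
  by (rule poly_mapping_eqI) simp

lemma lin_zero:
  assumes "lin f"
  shows "f 0 = 0"
proof -
  have "f (0 *\<^sub>v 0) = 0 *\<^sub>v f 0" using assms unfolding lin_iff by blast
  then show ?thesis by simp
qed

lemma lin_sum: "lin f \<Longrightarrow> f (\<Sum>i\<in>A. r i *\<^sub>v x i) = (\<Sum>i\<in>A. r i *\<^sub>v f (x i))"
  by (induction A rule: infinite_finite_induct) (auto simp: lin_iff lin_zero)

lemma lin_ext_vec: "lin_ext vec x = x"
  by (rule ev_eqI) simp

lemma lin_eq_lin_ext:
  assumes "lin f"
  shows "f x = lin_ext (\<lambda>b. f (vec b)) x"
proof -
  have "f (lin_ext vec x) = lin_ext (\<lambda>b. f (vec b)) x"
    unfolding lin_ext_def by (rule lin_sum [OF assms])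
  then show ?thesis by (simp add: lin_ext_vec)
qed

lemma lin_ext_single [simp]: "lin_ext f (vec b) = f b"
  by (rule ev_eqI) simp

lemma lin_eqI:
  assumes "lin f" "lin g" "\<And>b. f (vec b) = g (vec b)"
  shows "f = g"
proof
  fix x show "f x = g x"
    unfolding lin_eq_lin_ext [OF assms(1), of x] lin_eq_lin_ext [OF assms(2), of x] assms(3) ..
qed

lemma ev_lin: "lin f \<Longrightarrow> ev c (f x) = ev (\<lambda>b. ev c (f (vec b))) x"
  by (simp add: lin_eq_lin_ext [of f x])

lemma ev_tensor [simp]: "ev (\<lambda>p. c (fst p) * c' (snd p)) (tensor x y) = ev c x * ev c' y"
  by (simp add: tensor_def)

lemma ev_tensor_map:
  "ev (\<lambda>p. c (fst p) * c' (snd p)) (tensor_map g h t)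
    = ev (\<lambda>p. ev c (g (vec (fst p))) * ev c' (h (vec (snd p)))) t"
  by (simp add: tensor_map_def case_prod_unfold)

text \<open>The indicator of a pair is a product of two indicators, so functionals of product form
  separate elements although they do not exhaust the dual.\<close>

lemma ev_tensor_eqI:
  fixes x y :: "'b \<times> 'c \<Rightarrow>\<^sub>0 'a::field"
  assumes "\<And>c c'. ev (\<lambda>p. c (fst p) * c' (snd p)) x = ev (\<lambda>p. c (fst p) * c' (snd p)) y"
  shows "x = y"
proof (rule poly_mapping_eqI)
  fix p :: "'b \<times> 'c"
  have "(\<lambda>p'. if p' = p then 1 else 0 :: 'a)
    = (\<lambda>p'. (if fst p' = fst p then 1 else 0) * (if snd p' = snd p then 1 else 0))"
    by (auto simp: fun_eq_iff prod_eq_iff)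
  then show "Poly_Mapping.lookup x p = Poly_Mapping.lookup y p"
    using assms [of "\<lambda>b. if b = fst p then 1 else 0" "\<lambda>b. if b = snd p then 1 else 0"]
    by (simp add: lookup_eq_ev)
qed

section \<open>Sums over unshuffles\<close>

text \<open>
  Each letter of the word goes to the left or to the right factor; going right, it is passed by the
  letters that go left after it, which produces the Koszul sign.
\<close>

fun shuf :: "(gvar list \<Rightarrow> gvar list \<Rightarrow> 'k::field) \<Rightarrow> gvar list \<Rightarrow> 'k" where
  "shuf P [] = P [] []"
| "shuf P (x # u) = shuf (\<lambda>a. P (x # a)) u
    + shuf (\<lambda>a b. (\<Prod>y\<leftarrow>a. ksign (gpar y) (gpar x)) * P a (x # b)) u"

text \<open>The sign of an unshuffle in terms of the set \<open>A\<close> of positions that go left: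
  its inversions are the pairs of a left position \<open>p\<close> and an earlier right position
  \<open>q\<close>.\<close>

definition cut_sign :: "gvar list \<Rightarrow> nat set \<Rightarrow> 'k::field"
  where "cut_sign u A =
    (\<Prod>(p, q)\<in>{(p, q). p \<in> A \<and> q < p \<and> q \<notin> A}. ksign (gpar (u ! p)) (gpar (u ! q)))"

lemma nths_eq_map:
  assumes "A \<subseteq> {..<length u}"
  shows "nths u A = map ((!) u) (sorted_list_of_set A)"
proof -
  have "nths u A = map ((!) u) (nths [0..<length u] A)"
    unfolding nths_map [symmetric] by (simp add: map_nth)
  moreover have "nths [0..<length u] A = sorted_list_of_set A"
  proof -
    have "finite A" using assms finite_subset by blast
    moreover have "set (nths [0..<length u] A) = A"
    proof (intro set_eqI iffI)
      fix x assume "x \<in> A"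
      with assms have "x < length u" "[0..<length u] ! x = x" by auto
      with \<open>x \<in> A\<close> show "x \<in> set (nths [0..<length u] A)"
        unfolding set_nths by (intro CollectI exI [of _ x]) simp
    qed (auto simp: set_nths)
    ultimately show ?thesis
      by (intro sorted_distinct_set_unique)
        (auto simp: sorted_nths distinct_nthsI)
  qed
  ultimately show ?thesis by simp
qed

lemma cut_sign_Cons_out:
  assumes "A \<subseteq> {..<length u}"
  shows "cut_sign (x # u) (Suc ` A) =
    (\<Prod>y\<leftarrow>nths u A. ksign (gpar y) (gpar x)) * (cut_sign u A :: 'k::field)"
proof -
  have fin: "finite A" using assms finite_subset by blast
  let ?X = "{(p, q). p \<in> A \<and> q < p \<and> q \<notin> A}"
  have finX: "finite ?X"
    by (rule finite_subset [of _ "A \<times> (\<Union>p\<in>A. {..<p})"]) (use fin in auto)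
  let ?f = "\<lambda>(p, q). ksign (gpar ((x # u) ! p)) (gpar ((x # u) ! q)) :: 'k"
  have "{(p, q). p \<in> Suc ` A \<and> q < p \<and> q \<notin> Suc ` A}
      = map_prod Suc Suc ` ?X \<union> (\<lambda>p. (Suc p, 0)) ` A"
  proof (intro set_eqI iffI)
    fix z assume z: "z \<in> {(p, q). p \<in> Suc ` A \<and> q < p \<and> q \<notin> Suc ` A}"
    then obtain p q where "z = (Suc p, q)" "p \<in> A" "q \<le> p" "q \<notin> Suc ` A" by auto
    then show "z \<in> map_prod Suc Suc ` ?X \<union> (\<lambda>p. (Suc p, 0)) ` A"
      by (cases q) (auto simp: image_iff)
  qed auto
  then have "cut_sign (x # u) (Suc ` A)
      = prod ?f (map_prod Suc Suc ` ?X) * prod ?f ((\<lambda>p. (Suc p, 0)) ` A)"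
    unfolding cut_sign_def by (simp, intro prod.union_disjoint) (use fin finX in auto)
  also have "prod ?f (map_prod Suc Suc ` ?X) = cut_sign u A"
    unfolding cut_sign_def
    by (subst prod.reindex) (simp_all add: inj_on_def case_prod_beta)
  also have "prod ?f ((\<lambda>p. (Suc p, 0)) ` A) = (\<Prod>p\<in>A. ksign (gpar (u ! p)) (gpar x))"
    by (subst prod.reindex) (auto simp: inj_on_def)
  also have "\<dots> = (\<Prod>y\<leftarrow>nths u A. ksign (gpar y) (gpar x))"
    using fin prod.distinct_set_conv_list [of "sorted_list_of_set A"
        "\<lambda>p. ksign (gpar (u ! p)) (gpar x)"]
    by (simp add: nths_eq_map [OF assms] o_def)
  finally show ?thesis by simp
qed

lemma cut_sign_Cons_in:
  assumes "A \<subseteq> {..<length u}"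
  shows "cut_sign (x # u) (insert 0 (Suc ` A)) = (cut_sign u A :: 'k::field)"
proof -
  let ?X = "{(p, q). p \<in> A \<and> q < p \<and> q \<notin> A}"
  have "{(p, q). p \<in> insert 0 (Suc ` A) \<and> q < p \<and> q \<notin> insert 0 (Suc ` A)}
      = map_prod Suc Suc ` ?X"
  proof (intro set_eqI iffI)
    fix z assume z: "z \<in> {(p, q). p \<in> insert 0 (Suc ` A) \<and> q < p \<and> q \<notin> insert 0 (Suc ` A)}"
    then obtain p q where "z = (Suc p, q)" "p \<in> A" "q \<le> p" "q \<notin> Suc ` A" "q \<noteq> 0" by auto
    then show "z \<in> map_prod Suc Suc ` ?X"
      by (cases q) (auto simp: image_iff)
  qed auto
  then show ?thesis unfolding cut_sign_def
    by (simp only: \<open>_ = map_prod Suc Suc ` _\<close>, subst prod.reindex)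
      (simp_all add: inj_on_def case_prod_beta)
qed

text \<open>Membership of position 0 in the subset matches the two summands in the recursion of
  \<open>shuf\<close>.\<close>

lemma subset_sum_eq_shuf:
  "(\<Sum>A\<in>Pow {..<length u}. cut_sign u A * P (nths u A) (nths u (- A))) = shuf P u"
proof (induction u arbitrary: P)
  case Nil
  then show ?case by (simp add: cut_sign_def)
next
  case (Cons x u)
  let ?n = "length u"
  let ?F = "\<lambda>A. cut_sign (x # u) A * P (nths (x # u) A) (nths (x # u) (- A))"
  have Pow: "Pow {..<length (x # u)}
      = (image Suc) ` Pow {..<?n} \<union> (\<lambda>A. insert 0 (Suc ` A)) ` Pow {..<?n}"
    by (simp add: lessThan_Suc_eq_insert_0 Pow_insert image_image Un_commute
        image_Pow_surj [OF refl, symmetric])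
  have inj2: "inj_on (\<lambda>A. insert 0 (Suc ` A)) (Pow {..<?n})"
  proof (rule inj_onI)
    fix A B assume "insert 0 (Suc ` A) = insert 0 (Suc ` B)"
    then have "Suc ` A = Suc ` B" by (subst (asm) insert_ident) auto
    then show "A = B" by (simp add: inj_image_eq_iff)
  qed
  have shift: "{j. Suc j \<in> Suc ` A} = A" "{j. Suc j \<in> insert 0 (Suc ` A)} = A"
    "{j. Suc j \<notin> Suc ` A} = - A" "{j. Suc j \<notin> insert 0 (Suc ` A)} = - A" for A
    by auto
  have "sum ?F (Pow {..<length (x # u)})
      = sum ?F ((image Suc) ` Pow {..<?n}) + sum ?F ((\<lambda>A. insert 0 (Suc ` A)) ` Pow {..<?n})"
    unfolding Pow by (intro sum.union_disjoint) auto
  also have "sum ?F ((\<lambda>A. insert 0 (Suc ` A)) ` Pow {..<?n}) = shuf (\<lambda>a. P (x # a)) u"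
    by (subst sum.reindex [OF inj2], subst Cons.IH [symmetric], intro sum.cong refl)
      (simp add: cut_sign_Cons_in nths_Cons shift del: Compl_insert image_Suc_lessThan)
  also have "sum ?F ((image Suc) ` Pow {..<?n})
      = shuf (\<lambda>a b. (\<Prod>y\<leftarrow>a. ksign (gpar y) (gpar x)) * P a (x # b)) u"
    by (subst sum.reindex, simp add: inj_on_def inj_image_eq_iff, subst Cons.IH [symmetric],
        intro sum.cong refl)
      (simp add: cut_sign_Cons_out nths_Cons shift algebra_simps)
  finally show ?case by simp
qed

lemma unshuffles_lists:
  assumes "\<sigma> \<in> unshuffles k n" "k \<le> n"
  shows "sorted_list_of_set (\<sigma> ` {..<k}) = map \<sigma> [0..<k]"
    and "sorted_list_of_set ({..<n} - \<sigma> ` {..<k}) = map \<sigma> [k..<n]"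
proof -
  have perm: "\<sigma> permutes {..<n}" and m1: "strict_mono_on {..<k} \<sigma>" and m2: "strict_mono_on {k..<n} \<sigma>"
    using assms by (auto simp: unshuffles_def)
  have inj: "inj \<sigma>" using perm permutes_inj by blast
  have split: "{..<n} = {..<k} \<union> {k..<n}" using assms(2) by auto
  have "\<sigma> ` {..<n} = {..<n}" using perm permutes_image by blast
  then have "{..<n} - \<sigma> ` {..<k} = \<sigma> ` {..<n} - \<sigma> ` {..<k}" by simp
  also have "\<dots> = \<sigma> ` ({..<n} - {..<k})" by (rule image_set_diff [OF inj, symmetric])
  also have "{..<n} - {..<k} = {k..<n}" using assms(2) by auto
  finally have im: "{..<n} - \<sigma> ` {..<k} = \<sigma> ` {k..<n}" .
  have "sorted (map \<sigma> [0..<k])" "sorted (map \<sigma> [k..<n])"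
    unfolding sorted_map
    by (rule sorted_wrt_mono_rel [OF _ sorted_wrt_upt],
        use m1 m2 in \<open>auto simp: strict_mono_on_def less_imp_le\<close>)+
  moreover have "distinct (map \<sigma> xs) \<longleftrightarrow> distinct xs" for xs
    using inj_on_subset [OF inj subset_UNIV] by (simp add: distinct_map)
  ultimately show "sorted_list_of_set (\<sigma> ` {..<k}) = map \<sigma> [0..<k]"
    "sorted_list_of_set ({..<n} - \<sigma> ` {..<k}) = map \<sigma> [k..<n]"
    unfolding im by (simp_all add: sorted_distinct_set_unique lessThan_atLeast0)
qed

text \<open>Being increasing on both blocks, an unshuffle lists its left image and the complement in
  order, so the left image determines it.\<close>

lemma bij_betw_unshuffles:
  assumes "k \<le> n"
  shows "bij_betw (\<lambda>\<sigma>. \<sigma> ` {..<k}) (unshuffles k n) {A \<in> Pow {..<n}. card A = k}"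
  unfolding bij_betw_def
proof
  show "inj_on (\<lambda>\<sigma>. \<sigma> ` {..<k}) (unshuffles k n)"
  proof (rule inj_onI, rule ext)
    fix \<sigma> \<tau> i assume st: "\<sigma> \<in> unshuffles k n" "\<tau> \<in> unshuffles k n" "\<sigma> ` {..<k} = \<tau> ` {..<k}"
    have "map \<sigma> [0..<k] = map \<tau> [0..<k]" "map \<sigma> [k..<n] = map \<tau> [k..<n]"
      unfolding unshuffles_lists [OF st(1) assms, symmetric]
        unshuffles_lists [OF st(2) assms, symmetric] st(3) by (rule refl)+
    then have "\<sigma> i = \<tau> i" if "i < n"
      using that by (cases "i < k") (auto simp: map_eq_conv)
    moreover have "\<sigma> i = i" "\<tau> i = i" if "\<not> i < n"
      using that st by (auto simp: unshuffles_def permutes_not_in)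
    ultimately show "\<sigma> i = \<tau> i" by (cases "i < n") auto
  qed
  show "(\<lambda>\<sigma>. \<sigma> ` {..<k}) ` unshuffles k n = {A \<in> Pow {..<n}. card A = k}"
  proof (intro set_eqI iffI)
    fix A assume "A \<in> (\<lambda>\<sigma>. \<sigma> ` {..<k}) ` unshuffles k n"
    then obtain \<sigma> where "A = \<sigma> ` {..<k}" and p: "\<sigma> permutes {..<n}"
      by (auto simp: unshuffles_def)
    moreover have "card (\<sigma> ` {..<k}) = k"
      using permutes_inj_on [OF p, of "{..<k}"] by (simp add: card_image)
    moreover have "\<sigma> ` {..<k} \<subseteq> \<sigma> ` {..<n}" using assms by (intro image_mono) simp
    ultimately show "A \<in> {A \<in> Pow {..<n}. card A = k}"
      by (simp add: permutes_image [OF p])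
  next
    fix A assume "A \<in> {A \<in> Pow {..<n}. card A = k}"
    then have A: "A \<subseteq> {..<n}" "card A = k" by auto
    then have fin: "finite A" using finite_subset by blast
    define l where "l = sorted_list_of_set A @ sorted_list_of_set ({..<n} - A)"
    have len: "length l = n" using A fin assms by (simp add: l_def card_Diff_subset)
    have dist: "distinct l" using fin by (auto simp: l_def)
    have set: "set l = {..<n}" using fin A by (auto simp: l_def)
    define \<sigma> where "\<sigma> = (\<lambda>i. if i < n then l ! i else i)"
    have "bij_betw ((!) l) {..<n} {..<n}"
      by (rule bij_betw_nth [OF dist]) (simp_all add: len set)
    then have "bij_betw \<sigma> {..<n} {..<n}"
      by (subst bij_betw_cong [of _ _ "(!) l"]) (simp_all add: \<sigma>_def)
    then have perm: "\<sigma> permutes {..<n}"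
      by (rule bij_imp_permutes) (simp add: \<sigma>_def)
    have 1: "\<sigma> i = sorted_list_of_set A ! i" if "i < k" for i
      using that A assms by (simp add: \<sigma>_def l_def nth_append)
    have 2: "\<sigma> i = sorted_list_of_set ({..<n} - A) ! (i - k)" if "k \<le> i" "i < n" for i
      using that A by (simp add: \<sigma>_def l_def nth_append)
    have "strict_mono_on {..<k} \<sigma>"
      unfolding strict_mono_on_def
      using A by (auto simp: 1 intro!: sorted_wrt_nth_less [OF strict_sorted_list_of_set])
    moreover have "strict_mono_on {k..<n} \<sigma>"
      unfolding strict_mono_on_def
      using A fin by (auto simp: 2 card_Diff_subset intro!: sorted_wrt_nth_less [OF strict_sorted_list_of_set])
    moreover have "\<sigma> ` {..<k} = A"
    proof -
      have "\<sigma> ` {..<k} = (!) (sorted_list_of_set A) ` {..<length (sorted_list_of_set A)}"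
        using A by (intro image_cong) (auto simp: 1)
      also have "\<dots> = set (sorted_list_of_set A)" by (auto simp: set_conv_nth)
      finally show ?thesis using fin by simp
    qed
    ultimately show "A \<in> (\<lambda>\<sigma>. \<sigma> ` {..<k}) ` unshuffles k n"
      using perm by (auto simp: unshuffles_def)
  qed
qed

text \<open>Monotonicity on the blocks leaves only inversions between a left and a right position,
  and \<open>\<sigma>\<close> carries them to the pairs counted in \<open>cut_sign\<close>.\<close>

lemma koszul_eq_cut_sign:
  assumes "\<sigma> \<in> unshuffles k (length u)" "k \<le> length u"
  shows "koszul u \<sigma> = (cut_sign u (\<sigma> ` {..<k}) :: 'k::field)"
proof -
  let ?n = "length u"
  have perm: "\<sigma> permutes {..<?n}" and m1: "strict_mono_on {..<k} \<sigma>" and m2: "strict_mono_on {k..<?n} \<sigma>"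
    using assms by (auto simp: unshuffles_def)
  have inj: "inj \<sigma>" using perm permutes_inj by blast
  let ?X = "{(i, j). i < j \<and> j < ?n \<and> \<sigma> i > \<sigma> j}"
  have X: "i < k \<and> k \<le> j" if "(i, j) \<in> ?X" for i j
  proof -
    have ij: "i < j" "j < ?n" "\<sigma> j < \<sigma> i" using that by auto
    have "k \<le> j"
      using strict_mono_onD [OF m1, of i j] ij by (cases "k \<le> j") auto
    moreover have "i < k"
      using strict_mono_onD [OF m2, of i j] ij by (cases "i < k") auto
    ultimately show ?thesis by simp
  qed
  have "{(p, q). p \<in> \<sigma> ` {..<k} \<and> q < p \<and> q \<notin> \<sigma> ` {..<k}} = map_prod \<sigma> \<sigma> ` ?X"
  proof (intro set_eqI iffI)
    fix z assume "z \<in> {(p, q). p \<in> \<sigma> ` {..<k} \<and> q < p \<and> q \<notin> \<sigma> ` {..<k}}"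
    then obtain i q where z: "z = (\<sigma> i, q)" "i < k" "q < \<sigma> i" "q \<notin> \<sigma> ` {..<k}" by auto
    have "\<sigma> i < ?n" using z(2) assms(2) permutes_in_image [OF perm, of i] by simp
    then have "q \<in> \<sigma> ` {..<?n}" using z permutes_image [OF perm] by simp
    then obtain j where j: "q = \<sigma> j" "j < ?n" by auto
    have "k \<le> j" using z(4) j(1) by (metis imageI lessThan_iff not_less)
    with j show "z \<in> map_prod \<sigma> \<sigma> ` ?X"
      using z by (intro image_eqI [of _ _ "(i, j)"]) (auto simp: not_less intro: less_le_trans)
  next
    fix z assume "z \<in> map_prod \<sigma> \<sigma> ` ?X"
    then obtain i j where z: "z = (\<sigma> i, \<sigma> j)" "(i, j) \<in> ?X" by auto
    with X [OF z(2)] inj show "z \<in> {(p, q). p \<in> \<sigma> ` {..<k} \<and> q < p \<and> q \<notin> \<sigma> ` {..<k}}"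
      by (auto simp: inj_image_mem_iff)
  qed
  moreover have "inj_on (map_prod \<sigma> \<sigma>) ?X"
    by (rule inj_onI) (auto simp: inj_eq [OF inj])
  ultimately show ?thesis
    unfolding cut_sign_def koszul_def by (simp add: prod.reindex case_prod_beta)
qed

lemma subword_eq_nths:
  assumes "\<sigma> \<in> unshuffles k (length u)" "k \<le> length u"
  shows "subword u \<sigma> 0 k = nths u (\<sigma> ` {..<k})"
    and "subword u \<sigma> k (length u) = nths u (- \<sigma> ` {..<k})"
proof -
  have perm: "\<sigma> permutes {..<length u}" using assms by (auto simp: unshuffles_def)
  then have sub: "\<sigma> ` {..<k} \<subseteq> {..<length u}"
    using assms(2) permutes_image [OF perm] by (metis image_mono lessThan_subset_iff)
  show "subword u \<sigma> 0 k = nths u (\<sigma> ` {..<k})"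
    unfolding nths_eq_map [OF sub] unshuffles_lists [OF assms] by (simp add: subword_def)
  have "nths u (- \<sigma> ` {..<k}) = nths u ({..<length u} - \<sigma> ` {..<k})"
    unfolding nths_def by (intro arg_cong [where f = "map fst"] filter_cong refl)
      (auto simp: set_zip)
  also have "\<dots> = subword u \<sigma> k (length u)"
    by (subst nths_eq_map) (auto simp: unshuffles_lists [OF assms] subword_def)
  finally show "subword u \<sigma> k (length u) = nths u (- \<sigma> ` {..<k})" by simp
qed

text \<open>Subsets are grouped by cardinality. The range starts at \<open>k = 0\<close> and ends at
  the full length; the summands that \<open>comult_word\<close> and \<open>coder_word\<close> omit
  will vanish because \<open>wprod [] = 0\<close>.\<close>

lemma unshuffle_sum_eq_shuf:
  "(\<Sum>k\<le>length u. \<Sum>\<sigma>\<in>unshuffles k (length u).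
      koszul u \<sigma> * P (subword u \<sigma> 0 k) (subword u \<sigma> k (length u))) = shuf P u"
proof -
  let ?n = "length u"
  let ?F = "\<lambda>A. cut_sign u A * P (nths u A) (nths u (- A))"
  have "(\<Sum>\<sigma>\<in>unshuffles k ?n. koszul u \<sigma> * P (subword u \<sigma> 0 k) (subword u \<sigma> k ?n))
      = sum ?F {A \<in> Pow {..<?n}. card A = k}" if "k \<le> ?n" for k
    unfolding sum.reindex_bij_betw [OF bij_betw_unshuffles [OF that], symmetric]
    by (intro sum.cong refl) (simp add: koszul_eq_cut_sign subword_eq_nths that)
  then have "(\<Sum>k\<le>?n. \<Sum>\<sigma>\<in>unshuffles k ?n. koszul u \<sigma> * P (subword u \<sigma> 0 k) (subword u \<sigma> k ?n))
      = (\<Sum>k\<le>?n. sum ?F {A \<in> Pow {..<?n}. card A = k})"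
    by (intro sum.cong) auto
  also have "\<dots> = sum ?F (Pow {..<?n})"
  proof (rule sum.group)
    show "card ` Pow {..<?n} \<subseteq> {..?n}"
      using card_mono [of "{..<?n}"] by auto
  qed auto
  finally show ?thesis by (simp add: subset_sum_eq_shuf)
qed

section \<open>Superfunctions dual to the symmetric algebra\<close>

text \<open>
  \<open>SF f f1 f2 f12\<close> stands for \<open>f + f1 \<theta>\<^sub>1 + f2 \<theta>\<^sub>2 + f12 \<theta>\<^sub>1\<theta>\<^sub>2\<close>, where \<open>x, \<theta>\<^sub>1, \<theta>\<^sub>2\<close> is dual to
  \<open>w\<^sub>3, w\<^sub>1, w\<^sub>2\<close>.
\<close>

datatype 'k sf = SF (c00: "'k fps") (c10: "'k fps") (c01: "'k fps") (c11: "'k fps")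

fun sf_add :: "'k::field sf \<Rightarrow> 'k sf \<Rightarrow> 'k sf" where
  "sf_add (SF f f1 f2 f12) (SF g g1 g2 g12) = SF (f + g) (f1 + g1) (f2 + g2) (f12 + g12)"

fun sf_scale :: "'k::field \<Rightarrow> 'k sf \<Rightarrow> 'k sf" where
  "sf_scale r (SF f f1 f2 f12) = SF (fps_const r * f) (fps_const r * f1) (fps_const r * f2) (fps_const r * f12)"

fun sf_mult :: "'k::field sf \<Rightarrow> 'k sf \<Rightarrow> 'k sf" where
  "sf_mult (SF f f1 f2 f12) (SF g g1 g2 g12) =
    SF (f * g) (f * g1 + f1 * g) (f * g2 + f2 * g) (f * g12 + f1 * g2 - f2 * g1 + f12 * g)"

text \<open>Left derivatives: d/dt2 has to pass t1, whence the sign at \<open>W2\<close>.\<close>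

fun sf_diff :: "gvar \<Rightarrow> 'k::field sf \<Rightarrow> 'k sf" where
  "sf_diff W1 (SF f f1 f2 f12) = SF f1 0 f12 0"
| "sf_diff W2 (SF f f1 f2 f12) = SF f2 (- f12) 0 0"
| "sf_diff W3 (SF f f1 f2 f12) = SF (fps_deriv f) (fps_deriv f1) (fps_deriv f2) (fps_deriv f12)"

definition vf :: "(gvar \<Rightarrow> 'k::field sf) \<Rightarrow> 'k sf \<Rightarrow> 'k sf" where
  "vf D F = sf_add (sf_add (sf_mult (D W1) (sf_diff W1 F)) (sf_mult (D W2) (sf_diff W2 F)))
    (sf_mult (D W3) (sf_diff W3 F))"

text \<open>
  The functional dual to \<open>w\<^sub>3\<^sup>n\<close> is \<open>x\<^sup>n / n!\<close>, whence the factorial.  As \<open>S(W)\<close> is reduced, the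
  functional \<open>cf F\<close> forgets the constant term of \<open>F\<close>.
\<close>

fun sfc :: "'k::field_char_0 sf \<Rightarrow> nat \<times> nat \<times> nat \<Rightarrow> 'k" where
  "sfc F (i1, i2, i3) = fact i3 * fps_nth (if i1 = 0 then if i2 = 0 then c00 F else c01 F
    else if i2 = 0 then c10 F else c11 F) i3"

definition cf :: "'k::field_char_0 sf \<Rightarrow> mindex \<Rightarrow> 'k" where
  "cf F I = sfc F (exps I)"

text \<open>\<open>MI (0, 0, 0)\<close> is no monomial of the reduced algebra, so the constant term
  is fixed separately; with the value 0, \<open>sf_of\<close> inverts \<open>cf\<close> on functions
  vanishing at the origin.\<close>

definition sf_of :: "(mindex \<Rightarrow> 'k::field_char_0) \<Rightarrow> 'k sf" where
  "sf_of c = SF (Abs_fps (\<lambda>n. if n = 0 then 0 else c (MI (0, 0, n)) / fact n))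
    (Abs_fps (\<lambda>n. c (MI (1, 0, n)) / fact n)) (Abs_fps (\<lambda>n. c (MI (0, 1, n)) / fact n))
    (Abs_fps (\<lambda>n. c (MI (1, 1, n)) / fact n))"

lemma exps_MI: "i1 \<le> 1 \<Longrightarrow> i2 \<le> 1 \<Longrightarrow> i1 + i2 + i3 \<ge> 1 \<Longrightarrow> exps (MI (i1, i2, i3)) = (i1, i2, i3)"
  by (rule MI_inverse) simp

lemma exps_MI_simps [simp]:
  "exps (MI (0, 0, Suc n)) = (0, 0, Suc n)" "exps (MI (Suc 0, 0, n)) = (1, 0, n)"
  "exps (MI (0, Suc 0, n)) = (0, 1, n)" "exps (MI (Suc 0, Suc 0, n)) = (1, 1, n)"
  by (simp_all add: exps_MI)

lemma mindex_cases [case_names even0 W1 W2 both]: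
  obtains n where "I = MI (0, 0, Suc n)" | n where "I = MI (1, 0, n)"
    | n where "I = MI (0, 1, n)" | n where "I = MI (1, 1, n)"
proof -
  obtain i1 i2 i3 where e: "exps I = (i1, i2, i3)" using prod_cases3 by blast
  have v: "i1 \<le> 1" "i2 \<le> 1" "i1 + i2 + i3 \<ge> 1" using exps [of I] unfolding e by auto
  have I: "I = MI (i1, i2, i3)" using exps_inverse [of I] unfolding e by simp
  have "i1 = 0 \<or> i1 = 1" "i2 = 0 \<or> i2 = 1" using v by auto
  moreover have "\<exists>n. i3 = Suc n" if "i1 = 0" "i2 = 0" using that v by (cases i3) auto
  ultimately show ?thesis using I that by blast
qed

lemma cf_sf_of [simp]: "cf (sf_of c) = c"
proof
  fix I show "cf (sf_of c) I = c I"
    by (cases I rule: mindex_cases) (simp_all add: cf_def sf_of_def del: fact_Suc)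
qed

lemma c00_sf_of [simp]: "fps_nth (c00 (sf_of c)) 0 = 0"
  by (simp add: sf_of_def)

lemma cf_eqI:
  assumes "cf F = cf H" "fps_nth (c00 F) 0 = fps_nth (c00 H) 0"
  shows "F = H"
proof (rule sf.expand, intro conjI fps_ext)
  fix n
  have e: "cf F I = cf H I" for I using assms(1) by simp
  show "fps_nth (c00 F) n = fps_nth (c00 H) n"
    using assms(2) e [of "MI (0, 0, n)"] by (cases n) (simp_all add: cf_def del: fact_Suc)
  show "fps_nth (c10 F) n = fps_nth (c10 H) n" "fps_nth (c01 F) n = fps_nth (c01 H) n"
    "fps_nth (c11 F) n = fps_nth (c11 H) n"
    using e [of "MI (1, 0, n)"] e [of "MI (0, 1, n)"] e [of "MI (1, 1, n)"]
    by (simp_all add: cf_def)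
qed

lemma sfc_sf_add: "sfc (sf_add F H) e = sfc F e + sfc H e"
  by (cases F; cases H; cases e) (simp add: algebra_simps)

lemma sfc_sf_scale: "sfc (sf_scale r F) e = r * sfc F e"
  by (cases F; cases e) (simp add: algebra_simps)

lemma cf_sf_add [simp]: "cf (sf_add F H) I = cf F I + cf H I"
  by (simp add: cf_def sfc_sf_add)

lemma cf_sf_scale [simp]: "cf (sf_scale r F) I = r * cf F I"
  by (simp add: cf_def sfc_sf_scale)

fun mono_word :: "nat \<times> nat \<times> nat \<Rightarrow> gvar list" where
  "mono_word (i1, i2, i3) = replicate i1 W1 @ replicate i2 W2 @ replicate i3 W3"

lemma mword_eq: "mword I = mono_word (exps I)"
  by (auto simp: mword_def split: prod.split)

lemma wprod_Cons: "u \<noteq> [] \<Longrightarrow> wprod (x # u) = lin_ext (lmul x) (wprod u)"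
  by (cases u) auto

lemma wprod_mono_word:
  assumes "i1 \<le> 1" "i2 \<le> 1" "i1 + i2 + i3 \<ge> 1"
  shows "wprod (mono_word (i1, i2, i3)) = (vec (MI (i1, i2, i3)) :: 'k::field S)"
proof -
  have 3: "wprod (replicate (Suc n) W3) = (vec (MI (0, 0, Suc n)) :: 'k S)" for n
  proof (induction n)
    case (Suc n)
    then show ?case using wprod_Cons [of "replicate (Suc n) W3" W3] by simp
  qed simp
  have 2: "wprod (W2 # replicate n W3) = (vec (MI (0, 1, n)) :: 'k S)" for n
    using 3 wprod_Cons [of "replicate n W3" W2] by (cases n) (auto intro: poly_mapping_eqI)
  have 1: "wprod (W1 # replicate n W3) = (vec (MI (1, 0, n)) :: 'k S)" for n
    using 3 wprod_Cons [of "replicate n W3" W1] by (cases n) auto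
  have 12: "wprod (W1 # W2 # replicate n W3) = (vec (MI (1, 1, n)) :: 'k S)" for n
    using 2 wprod_Cons [of "W2 # replicate n W3" W1] by simp
  have "i1 = 0 \<or> i1 = 1" "i2 = 0 \<or> i2 = 1" using assms by auto
  then show ?thesis using 1 2 12 3 [of "i3 - 1"] assms(3) by (cases i3) auto
qed

lemma wprod_mword [simp]: "wprod (mword I) = vec I"
proof (cases I rule: mindex_cases)
  case (even0 n)
  then show ?thesis using wprod_mono_word [of 0 0 "Suc n"] by (simp add: mword_eq)
next
  case (W1 n)
  then show ?thesis using wprod_mono_word [of 1 0 n] by (simp add: mword_eq)
next
  case (W2 n)
  then show ?thesis using wprod_mono_word [of 0 1 n] by (simp add: mword_eq)
next
  case (both n)
  then show ?thesis using wprod_mono_word [of 1 1 n] by (simp add: mword_eq)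
qed

section \<open>Duality of unshuffles with products and derivations\<close>

lemma shuf_add: "shuf (\<lambda>a b. P a b + Q a b) u = shuf P u + shuf Q u"
  by (induction u arbitrary: P Q) (simp_all add: distrib_left)

lemma ksign_right_zero [simp]: "ksign p 0 = 1"
  by (simp add: ksign_def)

lemma ksign_left_zero [simp]: "ksign 0 p = 1"
  by (simp add: ksign_def)

lemma ksign_one [simp]: "ksign 1 1 = - 1"
  by (simp add: ksign_def)

lemma prod_list_const_one [simp]: "(\<Prod>y\<leftarrow>a. 1) = (1 :: 'k::field)"
  by (induction a) auto

text \<open>No signs arise among even letters, so only the number of subsets of each size counts;
  the induction step is Pascal's rule.\<close>

lemma shuf_W3:
  "shuf P (replicate n W3) =
    (\<Sum>j\<le>n. of_nat (n choose j) * P (replicate j W3) (replicate (n - j) W3))"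
proof (induction n arbitrary: P)
  case (Suc n)
  let ?f = "\<lambda>j. P (replicate j W3) (replicate (Suc n - j) W3)"
  have "shuf P (replicate (Suc n) W3) =
      (\<Sum>j\<le>n. of_nat (n choose j) * ?f (Suc j)) + (\<Sum>j\<le>n. of_nat (n choose j) * ?f j)"
    by (simp add: Suc.IH Suc_diff_le)
  also have "(\<Sum>j\<le>n. of_nat (n choose j) * ?f j) = (\<Sum>j\<le>Suc n. of_nat (n choose j) * ?f j)"
    by (simp add: binomial_eq_0)
  also have "\<dots> = ?f 0 + (\<Sum>j\<le>n. of_nat (n choose Suc j) * ?f (Suc j))"
    by (subst sum.atMost_Suc_shift) simp
  also have "(\<Sum>j\<le>n. of_nat (n choose j) * ?f (Suc j)) + \<dots> =
      (\<Sum>j\<le>Suc n. of_nat (Suc n choose j) * ?f j)"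
    by (subst sum.atMost_Suc_shift) (simp add: sum.distrib distrib_right)
  finally show ?case .
qed simp

text \<open>The factorials in \<open>sfc\<close> turn the binomial convolution from
  \<open>shuf_W3\<close> into the Cauchy product.\<close>

lemma fact_fps_mult_nth:
  fixes f g :: "'k::field_char_0 fps"
  shows "(\<Sum>j\<le>n. of_nat (n choose j) * (fact j * fps_nth f j * (fact (n - j) * fps_nth g (n - j))))
    = fact n * fps_nth (f * g) n"
proof -
  have "of_nat (n choose j) * (fact j * fps_nth f j * (fact (n - j) * fps_nth g (n - j)))
      = fact n * (fps_nth f j * fps_nth g (n - j))" if "j \<le> n" for j
  proof -
    have "(of_nat (fact j * fact (n - j) * (n choose j)) :: 'k) = of_nat (fact n)"
      using binomial_fact_lemma [OF that] by simp
    then show ?thesis by (simp add: algebra_simps)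
  qed
  then have "(\<Sum>j\<le>n. of_nat (n choose j) * (fact j * fps_nth f j * (fact (n - j) * fps_nth g (n - j))))
      = (\<Sum>j\<le>n. fact n * (fps_nth f j * fps_nth g (n - j)))"
    by (intro sum.cong) auto
  then show ?thesis
    by (simp add: fps_mult_nth sum_distrib_left atMost_atLeast0)
qed

text \<open>Subwords of an ordered word are ordered, and \<open>W1\<close>, \<open>W2\<close> occur
  at most once, so the recursion of \<open>shuf\<close> is unfolded over the odd letters and
  \<open>shuf_W3\<close> treats the rest. The minus sign in \<open>sf_mult\<close> arises when
  \<open>W2\<close> goes left and \<open>W1\<close> goes right.\<close>

lemma shuf_mono_word:
  fixes F H :: "'k::field_char_0 sf"
  assumes P: "\<And>i1 i2 i3 j1 j2 j3. i1 \<le> 1 \<Longrightarrow> i2 \<le> 1 \<Longrightarrow> j1 \<le> 1 \<Longrightarrow> j2 \<le> 1 \<Longrightarrow>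
      P (mono_word (i1, i2, i3)) (mono_word (j1, j2, j3)) = sfc F (i1, i2, i3) * sfc H (j1, j2, j3)"
    and "i1 \<le> 1" "i2 \<le> 1"
  shows "shuf P (mono_word (i1, i2, i3)) = sfc (sf_mult F H) (i1, i2, i3)"
proof -
  obtain f f1 f2 f12 g g1 g2 g12 where FH: "F = SF f f1 f2 f12" "H = SF g g1 g2 g12"
    using sf.exhaust by metis
  \<comment> \<open>Each odd letter goes left, goes right or is absent: nine cases.\<close>
  note P' = P [of 0 0 0 0, simplified] P [of 1 0 0 0, simplified] P [of 0 1 0 0, simplified]
    P [of 1 1 0 0, simplified] P [of 0 0 1 0, simplified] P [of 0 0 0 1, simplified]
    P [of 0 0 1 1, simplified] P [of 1 0 0 1, simplified] P [of 0 1 1 0, simplified]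
  have "i1 = 0 \<or> i1 = 1" "i2 = 0 \<or> i2 = 1" using assms by auto
  then show ?thesis
    by (elim disjE; simp add: shuf_W3 P' FH fact_fps_mult_nth sum_negf algebra_simps
        del: of_nat_mult)
      (simp_all add: fact_fps_mult_nth [symmetric] algebra_simps sum_negf)
qed

text \<open>The constant term must vanish because of the empty word, where \<open>wprod\<close> has
  its dummy value 0.\<close>

lemma ev_cf_wprod:
  assumes "fps_nth (c00 F) 0 = 0" "i1 \<le> 1" "i2 \<le> 1"
  shows "ev (cf F) (wprod (mono_word (i1, i2, i3))) = sfc F (i1, i2, i3)"
proof (cases "i1 + i2 + i3 \<ge> 1")
  case True
  then show ?thesis using assms by (subst wprod_mono_word) (auto simp: cf_def exps_MI)
next
  case False
  then have "i1 = 0" "i2 = 0" "i3 = 0" by auto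
  then show ?thesis using assms by simp
qed

text \<open>Left multiplication by a letter is transposed to the left derivative; for
  \<open>W3\<close> the factorials account for the exponent that \<open>fps_deriv\<close> brings
  down.\<close>

lemma ev_cf_wprod_Cons:
  fixes F :: "'a::field_char_0 sf"
  assumes "i1 \<le> 1" "i2 \<le> 1"
  shows "ev (cf F) (wprod (j # mono_word (i1, i2, i3))) = sfc (sf_diff j F) (i1, i2, i3)"
proof (cases "i1 + i2 + i3 \<ge> 1")
  case True
  obtain f f1 f2 f12 where F: "F = SF f f1 f2 f12" using sf.exhaust by metis
  have ne: "mono_word (i1, i2, i3) \<noteq> []" using True by auto
  have i: "i1 = 0 \<or> i1 = 1" "i2 = 0 \<or> i2 = 1" using assms by auto
  have "wprod (j # mono_word (i1, i2, i3)) = (lmul j (MI (i1, i2, i3)) :: 'a S)"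
    unfolding wprod_Cons [OF ne] wprod_mono_word [OF assms True] by simp
  then show ?thesis using i True assms
    by (cases j) (auto simp: exps_MI cf_def F simp del: mono_word.simps wprod.simps)
next
  case False
  then have "i1 = 0" "i2 = 0" "i3 = 0" by auto
  then show ?thesis by (cases F; cases j) (auto simp: cf_def)
qed

lemma sum_extend_zero:
  fixes f :: "nat \<Rightarrow> 'k::field"
  assumes "finite B" "A \<subseteq> B" "\<And>k. k \<in> B - A \<Longrightarrow> f k = 0"
  shows "sum f A = sum f B"
  using assms by (intro sum.mono_neutral_left) auto

lemma ev_comult:
  fixes F H :: "'k::field_char_0 sf"
  assumes "fps_nth (c00 F) 0 = 0" "fps_nth (c00 H) 0 = 0"
  shows "ev (\<lambda>p. cf F (fst p) * cf H (snd p)) (comult u) = ev (cf (sf_mult F H)) u"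
proof -
  have "ev (\<lambda>p. cf F (fst p) * cf H (snd p)) (comult_word (mword I)) = cf (sf_mult F H) I" for I
  proof -
    let ?u = "mword I" and ?P = "\<lambda>a b. ev (cf F) (wprod a) * ev (cf H) (wprod b)"
    let ?n = "length ?u"
    obtain i1 i2 i3 where e: "exps I = (i1, i2, i3)" using prod_cases3 by blast
    have v: "i1 \<le> 1" "i2 \<le> 1" using exps [of I] unfolding e by auto
    have "ev (\<lambda>p. cf F (fst p) * cf H (snd p)) (comult_word ?u)
      = (\<Sum>k = 1..<?n. \<Sum>\<sigma>\<in>unshuffles k ?n. koszul ?u \<sigma> * ?P (subword ?u \<sigma> 0 k) (subword ?u \<sigma> k ?n))"
      by (simp add: comult_word_def Let_def ev_sum)
    also have "\<dots> = (\<Sum>k\<le>?n. \<Sum>\<sigma>\<in>unshuffles k ?n. koszul ?u \<sigma> * ?P (subword ?u \<sigma> 0 k) (subword ?u \<sigma> k ?n))"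
    proof (rule sum_extend_zero)
      fix k assume "k \<in> {..?n} - {1..<?n}"
      then have "k = 0 \<or> k = ?n" by auto
      then show "(\<Sum>\<sigma>\<in>unshuffles k ?n. koszul ?u \<sigma> * ?P (subword ?u \<sigma> 0 k) (subword ?u \<sigma> k ?n)) = 0"
        by (auto simp: subword_def)
    qed auto
    also have "\<dots> = shuf ?P ?u" by (rule unshuffle_sum_eq_shuf)
    also have "\<dots> = cf (sf_mult F H) I"
      unfolding mword_eq cf_def [of _ I] e
      by (rule shuf_mono_word [OF _ v]) (simp only: ev_cf_wprod assms)
    finally show ?thesis .
  qed
  then show ?thesis by (simp add: comult_def)
qed

text \<open>The coefficient of d/dt1, d/dt2 or d/dx when \<open>\<phi>\<close> is read as a vector
  field.\<close>

definition coef :: "'k::field_char_0 L \<Rightarrow> gvar \<Rightarrow> 'k sf" where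
  "coef \<phi> j = sf_of (\<lambda>I. Poly_Mapping.lookup (\<phi> (vec I)) j)"

lemma ev_lookup:
  assumes "lin \<phi>"
  shows "Poly_Mapping.lookup (\<phi> x) j = ev (cf (coef \<phi> j)) x"
  unfolding coef_def cf_sf_of lookup_eq_ev by (rule ev_lin [OF assms])

text \<open>The coderivation feeds the left block to \<open>\<phi>\<close> and multiplies the
  resulting letter in front of the right block. Dually, a coefficient of the field multiplies a left
  derivative, summed over the three possible letters.\<close>

lemma ev_coder:
  fixes F :: "'k::field_char_0 sf"
  assumes "lin \<phi>"
  shows "ev (cf F) (coder \<phi> x) = ev (cf (vf (coef \<phi>) F)) x"
proof -
  have "ev (cf F) (coder_word \<phi> (mword I)) = cf (vf (coef \<phi>) F) I" for I
  proof -
    let ?Q = "\<lambda>j a b. ev (cf (coef \<phi> j)) (wprod a) * ev (cf F) (wprod (j # b))"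
    let ?u = "mword I" and ?P = "\<lambda>a b. ?Q W1 a b + ?Q W2 a b + ?Q W3 a b"
    let ?n = "length ?u"
    obtain i1 i2 i3 where e: "exps I = (i1, i2, i3)" using prod_cases3 by blast
    have v: "i1 \<le> 1" "i2 \<le> 1" using exps [of I] unfolding e by auto
    have "ev (cf F) (wmul (\<phi> (wprod a)) b) = ?P a b" for a b
      by (simp add: wmul_def ev_gvar ev_lookup [OF assms] add.assoc)
    then have "ev (cf F) (coder_word \<phi> ?u)
      = (\<Sum>k = 1..?n. \<Sum>\<sigma>\<in>unshuffles k ?n. koszul ?u \<sigma> * ?P (subword ?u \<sigma> 0 k) (subword ?u \<sigma> k ?n))"
      by (simp add: coder_word_def Let_def ev_sum)
    also have "\<dots> = (\<Sum>k\<le>?n. \<Sum>\<sigma>\<in>unshuffles k ?n. koszul ?u \<sigma> * ?P (subword ?u \<sigma> 0 k) (subword ?u \<sigma> k ?n))"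
    proof (rule sum_extend_zero)
      fix k assume "k \<in> {..?n} - {1..?n}"
      then have "k = 0" by auto
      then show "(\<Sum>\<sigma>\<in>unshuffles k ?n. koszul ?u \<sigma> * ?P (subword ?u \<sigma> 0 k) (subword ?u \<sigma> k ?n)) = 0"
        by (simp add: subword_def)
    qed auto
    also have "\<dots> = shuf ?P ?u" by (rule unshuffle_sum_eq_shuf)
    also have "\<dots> = shuf (?Q W1) ?u + shuf (?Q W2) ?u + shuf (?Q W3) ?u"
      by (simp only: shuf_add)
    also have "\<dots> = cf (vf (coef \<phi>) F) I"
    proof -
      have "shuf (?Q j) ?u = sfc (sf_mult (coef \<phi> j) (sf_diff j F)) (i1, i2, i3)" for j
        unfolding mword_eq e
        by (rule shuf_mono_word [OF _ v])
          (simp only: ev_cf_wprod ev_cf_wprod_Cons coef_def c00_sf_of)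
      then show ?thesis by (simp only: cf_def [of _ I] e vf_def sfc_sf_add)
    qed
    finally show ?thesis .
  qed
  then show ?thesis by (simp add: coder_def)
qed

section \<open>Codifferentials as vector fields\<close>

lemma lookup_lin_ext:
  "Poly_Mapping.lookup (lin_ext f x) c =
    (\<Sum>b\<in>Poly_Mapping.keys x. Poly_Mapping.lookup x b * Poly_Mapping.lookup (f b) c)"
  unfolding lin_ext_def by (simp add: lookup_sum)

lemma has_parity_iff:
  assumes "lin f"
  shows "has_parity gr gr' p f \<longleftrightarrow>
    (\<forall>b c. gr' c \<noteq> p + gr b \<longrightarrow> Poly_Mapping.lookup (f (vec b)) c = 0)"
proof
  assume h: "has_parity gr gr' p f"
  show "\<forall>b c. gr' c \<noteq> p + gr b \<longrightarrow> Poly_Mapping.lookup (f (vec b)) c = 0"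
  proof (intro allI impI)
    fix b c assume "gr' c \<noteq> p + gr b"
    moreover have "\<forall>c\<in>Poly_Mapping.keys (f (vec b)). gr' c = p + gr b"
      using h [unfolded has_parity_def, THEN spec, of "gr b", THEN spec, of "vec b"] by simp
    ultimately show "Poly_Mapping.lookup (f (vec b)) c = 0" by (auto simp: in_keys_iff)
  qed
next
  assume h: "\<forall>b c. gr' c \<noteq> p + gr b \<longrightarrow> Poly_Mapping.lookup (f (vec b)) c = 0"
  show "has_parity gr gr' p f"
    unfolding has_parity_def
  proof (intro allI impI ballI, rule ccontr)
    fix q x c assume x: "\<forall>b\<in>Poly_Mapping.keys x. gr b = q" and c: "c \<in> Poly_Mapping.keys (f x)"
      and ne: "gr' c \<noteq> p + q"
    have "Poly_Mapping.lookup (f x) c = 0"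
      unfolding lin_eq_lin_ext [OF assms, of x] lookup_lin_ext using h x ne
      by (intro sum.neutral) auto
    with c show False by (simp add: in_keys_iff)
  qed
qed

lemma lookup_proj:
  fixes x :: "'b \<Rightarrow>\<^sub>0 'a::field"
  shows
  "Poly_Mapping.lookup (proj gr p x) b = (if gr b = p then Poly_Mapping.lookup x b else 0)"
proof -
  have "(\<lambda>b'. ev (\<lambda>b'. if b' = b then 1 else 0 :: 'a) (if gr b' = p then vec b' else 0))
      = (\<lambda>b'. (if gr b = p then 1 else 0) * (if b' = b then 1 else 0))"
    by (auto simp: fun_eq_iff)
  then show ?thesis
    unfolding proj_def lookup_eq_ev [of _ b] ev_lin_ext by simp
qed

lemma proj_vec: "proj gr p (vec b) = (if gr b = p then vec b else 0)"
  by (simp add: proj_def)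

lemma lin_proj: "lin (proj gr p)"
  unfolding proj_def by (rule lin_lin_ext)

lemma par_comp_odd:
  assumes "lin d" "has_parity mpar gpar 1 d"
  shows "par_comp 1 d = d" "par_comp 0 d = (\<lambda>x. 0)"
proof -
  have proj: "proj gpar (p + q) (d (proj mpar q x)) = (if p = 1 then d (proj mpar q x) else 0)" for p q x
  proof -
    have "\<forall>b\<in>Poly_Mapping.keys (proj mpar q x). mpar b = q"
      by (auto simp: in_keys_iff lookup_proj split: if_splits)
    then have k: "\<forall>c\<in>Poly_Mapping.keys (d (proj mpar q x)). gpar c = 1 + q"
      using assms(2) unfolding has_parity_def by blast
    have "Poly_Mapping.lookup (d (proj mpar q x)) c = 0" if "gpar c \<noteq> 1 + q" for c
      using that k by (auto simp: in_keys_iff)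
    then show ?thesis
      by (intro poly_mapping_eqI) (cases p; cases q; auto simp: lookup_proj)
  qed
  have split: "proj mpar 0 x + proj mpar 1 x = x" for x :: "'a S"
  proof (rule poly_mapping_eqI)
    fix I show "Poly_Mapping.lookup (proj mpar 0 x + proj mpar 1 x) I = Poly_Mapping.lookup x I"
      by (cases "mpar I") (simp_all add: lookup_add lookup_proj)
  qed
  show "par_comp 1 d = d"
  proof
    fix x
    have "par_comp 1 d x = d (proj mpar 0 x) + d (proj mpar 1 x)"
      using proj [of 1 0 x] proj [of 1 1 x] by (simp add: par_comp_def)
    also have "\<dots> = d (proj mpar 0 x + proj mpar 1 x)" using assms(1) by (simp add: lin_iff)
    finally show "par_comp 1 d x = d x" by (simp add: split)
  qed
  show "par_comp 0 d = (\<lambda>x. 0)"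
    using proj [of 0 0] proj [of 0 1] by (simp add: par_comp_def fun_eq_iff)
qed

lemma coder_zero: "coder (\<lambda>x. 0) x = 0"
  by (simp add: coder_def coder_word_def wmul_def lin_ext_def)

text \<open>For odd \<open>d\<close> the sign in the bracket is -1, so \<open>bracket d d\<close> is
  twice \<open>d\<close> after \<open>coder d\<close>, and 2 is invertible.\<close>

lemma codifferential_iff:
  fixes d :: "'k::field_char_0 L"
  shows "codifferential d \<longleftrightarrow> lin d \<and> has_parity mpar gpar 1 d \<and> (\<forall>x. d (coder d x) = 0)"
proof -
  have "bracket d d = (\<lambda>x. 0) \<longleftrightarrow> (\<forall>x. d (coder d x) = 0)"
    if "lin d" "has_parity mpar gpar 1 d"
  proof -
    have "bracket d d x = d (coder d x) + d (coder d x)" for x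
    proof (rule poly_mapping_eqI)
      fix c show "Poly_Mapping.lookup (bracket d d x) c = Poly_Mapping.lookup (d (coder d x) + d (coder d x)) c"
        unfolding bracket_def
        by (simp add: par_comp_odd [OF that, simplified] coder_zero lin_zero [OF that(1)] lookup_add lookup_minus)
    qed
    then have *: "Poly_Mapping.lookup (bracket d d x) c = 2 * Poly_Mapping.lookup (d (coder d x)) c" for x c
      by (simp add: lookup_add)
    show ?thesis unfolding fun_eq_iff poly_mapping_eq_iff * by (simp add: fun_eq_iff)
  qed
  then show ?thesis unfolding codifferential_def by blast
qed

lemma c00_vf:
  assumes "\<And>j. fps_nth (c00 (D j)) 0 = 0"
  shows "fps_nth (c00 (vf D F)) 0 = 0"
proof -
  have "fps_nth (c00 (sf_mult G H)) 0 = fps_nth (c00 G) 0 * fps_nth (c00 H) 0" for G H :: "'a sf"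
    by (cases G; cases H) simp
  moreover have "fps_nth (c00 (sf_add G H)) 0 = fps_nth (c00 G) 0 + fps_nth (c00 H) 0" for G H :: "'a sf"
    by (cases G; cases H) simp
  ultimately show ?thesis using assms by (simp add: vf_def)
qed

lemma c00_coef [simp]: "fps_nth (c00 (coef d j)) 0 = 0"
  by (simp add: coef_def)

lemma sfc_zero [simp]: "sfc (SF 0 0 0 0) e = 0"
  by (cases e) simp

text \<open>The components of \<open>d\<close> after \<open>coder d\<close> are the field applied to
  its own coefficients, so Q^2 only has to be tested on the coordinates.\<close>

lemma square_zero_iff:
  fixes d :: "'k::field_char_0 L"
  assumes "lin d"
  shows "(\<forall>x. d (coder d x) = 0) \<longleftrightarrow> (\<forall>j. vf (coef d) (coef d j) = SF 0 0 0 0)"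
proof -
  have *: "Poly_Mapping.lookup (d (coder d x)) j = ev (cf (vf (coef d) (coef d j))) x" for x j
    by (simp add: ev_lookup [OF assms] ev_coder [OF assms])
  have z: "cf (SF 0 0 0 0 :: 'k sf) = (\<lambda>I. 0)"
    by (simp add: cf_def fun_eq_iff)
  have "(\<forall>x. ev (cf (vf (coef d) (coef d j))) x = 0) \<longleftrightarrow> vf (coef d) (coef d j) = SF 0 0 0 0" for j
  proof
    assume "\<forall>x. ev (cf (vf (coef d) (coef d j))) x = 0"
    then have "cf (vf (coef d) (coef d j)) I = 0" for I by (metis ev_single mult_1)
    then show "vf (coef d) (coef d j) = SF 0 0 0 0"
      by (intro cf_eqI) (auto simp: z c00_vf)
  qed (simp add: z)
  then show ?thesis unfolding poly_mapping_eq_iff fun_eq_iff * by simp blast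
qed

lemma MI_eq_iff:
  assumes "i1 \<le> 1" "i2 \<le> 1" "i1 + i2 + i3 \<ge> 1"
  shows "J = MI (i1, i2, i3) \<longleftrightarrow> exps J = (i1, i2, i3)"
  using exps_MI [OF assms] exps_inverse [of J] by metis

section \<open>The given codifferentials and the extensions in coordinates\<close>

lemma lin_phi: "lin (phi I j)"
  unfolding phi_def by (rule lin_lin_ext)

lemma lin_d_inf: "lin (d_inf m)"
  unfolding d_inf_def by (rule lin_phi)

lemma lin_d_fam: "lin (d_fam m n a)"
proof -
  have "d_fam m n a (x + y) = d_fam m n a x + d_fam m n a y"
    "d_fam m n a (r *\<^sub>v x) = r *\<^sub>v d_fam m n a x" for x y r
    by (auto simp: lin_phi [unfolded lin_iff] d_fam_def lookup_add algebra_simps intro!: poly_mapping_eqI)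
  then show ?thesis unfolding lin_iff by blast
qed

text \<open>The coefficient of t2 d/dx in \<open>d_fam\<close>: the factor \<open>I!\<close> in
  \<open>phi\<close> cancels against the factorial in \<open>sfc\<close>.\<close>

definition fam_series :: "nat \<Rightarrow> nat \<Rightarrow> 'k::field \<Rightarrow> 'k fps" where
  "fam_series m n a = fps_X ^ (n + 1) + fps_const a * fps_X ^ (2 * n - m + 1)"

lemma phi_vec: "phi e j (vec I) = (if I = MI e then of_nat (mfact I) *\<^sub>v vec j else 0)"
  by (simp add: phi_def)

lemma coef_d_inf:
  "coef (d_inf m :: 'k::field_char_0 L) j = (if j = W1 then SF 0 0 0 (fps_X ^ m) else SF 0 0 0 0)"
proof (rule cf_eqI)
  show "cf (coef (d_inf m :: 'k L) j) = cf (if j = W1 then SF 0 0 0 (fps_X ^ m) else SF 0 0 0 0)"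
  proof
    fix I
    show "cf (coef (d_inf m :: 'k L) j) I = cf (if j = W1 then SF 0 0 0 (fps_X ^ m) else SF 0 0 0 0) I"
      by (cases I rule: mindex_cases; cases j)
        (auto simp: coef_def d_inf_def phi_vec MI_eq_iff cf_def mfact_def fps_X_power_nth lookup_single)
  qed
qed (simp split: if_splits)

lemma coef_d_fam:
  "coef (d_fam m n a :: 'k::field_char_0 L) j =
    (if j = W1 then SF 0 0 0 (fps_X ^ m)
     else if j = W3 then SF 0 0 (fam_series m n a) 0 else SF 0 0 0 0)"
  (is "_ = ?R")
proof (rule cf_eqI)
  show "cf (coef (d_fam m n a :: 'k L) j) = cf ?R"
  proof
    fix I
    show "cf (coef (d_fam m n a :: 'k L) j) I = cf ?R I"
      by (cases I rule: mindex_cases; cases j)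
        (auto simp: coef_def d_fam_def phi_vec MI_eq_iff cf_def mfact_def fps_X_power_nth
          lookup_single lookup_add fam_series_def distrib_left simp del: fact_Suc)
  qed
qed (simp split: if_splits)

lemma mpar_simps [simp]:
  "mpar (MI (0, 0, Suc n)) = 0" "mpar (MI (Suc 0, 0, n)) = 1"
  "mpar (MI (0, Suc 0, n)) = 1" "mpar (MI (Suc 0, Suc 0, n)) = 0"
  by (simp_all add: mpar_def)

lemma all_nat_split0: "(\<forall>n. P n) \<longleftrightarrow> P 0 \<and> (\<forall>n. P (Suc n))"
  by (metis not0_implies_Suc)

lemma has_parity_odd_iff:
  fixes d :: "'k::field_char_0 L"
  assumes "lin d"
  shows "has_parity mpar gpar 1 d \<longleftrightarrow>
    c10 (coef d W1) = 0 \<and> c01 (coef d W1) = 0 \<and> c10 (coef d W2) = 0 \<and> c01 (coef d W2) = 0 \<and>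
    c00 (coef d W3) = 0 \<and> c11 (coef d W3) = 0"
proof -
  have "(\<forall>I j. gpar j \<noteq> 1 + mpar I \<longrightarrow> Poly_Mapping.lookup (d (vec I)) j = 0) \<longleftrightarrow>
    (\<forall>n. Poly_Mapping.lookup (d (vec (MI (1, 0, n)))) W1 = 0 \<and> Poly_Mapping.lookup (d (vec (MI (0, 1, n)))) W1 = 0 \<and>
      Poly_Mapping.lookup (d (vec (MI (1, 0, n)))) W2 = 0 \<and> Poly_Mapping.lookup (d (vec (MI (0, 1, n)))) W2 = 0 \<and>
      Poly_Mapping.lookup (d (vec (MI (0, 0, Suc n)))) W3 = 0 \<and> Poly_Mapping.lookup (d (vec (MI (1, 1, n)))) W3 = 0)"
    (is "?l = ?r")
  proof
    assume ?l
    then show ?r by simp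
  next
    assume r: ?r
    show ?l
    proof (intro allI impI)
      fix I j assume "gpar j \<noteq> 1 + mpar I"
      then show "Poly_Mapping.lookup (d (vec I)) j = 0"
        using r by (cases I rule: mindex_cases; cases j) auto
    qed
  qed
  moreover have "Poly_Mapping.lookup (d (vec I)) j = cf (coef d j) I" for I j
    by (simp add: coef_def)
  moreover have "c10 (coef d j) = 0 \<longleftrightarrow> (\<forall>n. cf (coef d j) (MI (1, 0, n)) = 0)"
    "c01 (coef d j) = 0 \<longleftrightarrow> (\<forall>n. cf (coef d j) (MI (0, 1, n)) = 0)"
    "c11 (coef d j) = 0 \<longleftrightarrow> (\<forall>n. cf (coef d j) (MI (1, 1, n)) = 0)" for j
    by (simp_all add: fps_eq_iff cf_def)
  moreover have "c00 (coef d j) = 0 \<longleftrightarrow> (\<forall>n. cf (coef d j) (MI (0, 0, Suc n)) = 0)" for j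
  proof -
    have "c00 (coef d j) = 0 \<longleftrightarrow> (\<forall>n. fps_nth (c00 (coef d j)) (Suc n) = 0)"
      unfolding fps_eq_iff by (subst all_nat_split0) simp
    then show ?thesis by (simp add: cf_def del: fact_Suc)
  qed
  ultimately show ?thesis
    unfolding has_parity_iff [OF assms] by (simp only:) blast
qed

lemma lin_deg_comp: "lin d \<Longrightarrow> lin (deg_comp k d)"
  by (simp add: lin_iff deg_comp_def lin_proj [unfolded lin_iff])

lemma deg_comp_vec: "lin d \<Longrightarrow> deg_comp k d (vec I) = (if mdeg I = k then d (vec I) else 0)"
  by (simp add: deg_comp_def proj_vec lin_zero)

lemma deg_comp_eq_iff:
  assumes "lin d" "lin d'"
  shows "deg_comp k d = d' \<longleftrightarrow> (\<forall>I. d' (vec I) = (if mdeg I = k then d (vec I) else 0))"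
proof
  assume "\<forall>I. d' (vec I) = (if mdeg I = k then d (vec I) else 0)"
  then show "deg_comp k d = d'"
    by (intro lin_eqI lin_deg_comp assms) (simp add: deg_comp_vec assms)
qed (auto simp: deg_comp_vec assms)

lemma lin_zero_map: "lin (\<lambda>x. 0)"
  by (auto simp: lin_iff intro: poly_mapping_eqI)

lemma mdeg_simps [simp]:
  "mdeg (MI (0, 0, Suc n)) = Suc n" "mdeg (MI (Suc 0, 0, n)) = Suc n"
  "mdeg (MI (0, Suc 0, n)) = Suc n" "mdeg (MI (Suc 0, Suc 0, n)) = Suc (Suc n)"
  by (simp_all add: mdeg_def)

text \<open>The general odd field (f0 + A t1 t2) d/dt1 + (g0 + E t1 t2) d/dt2 + (h1 t1 + h2 t2)
  d/dx. These letters keep their meaning below.\<close>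

lemma vf_odd:
  assumes "D W1 = SF f0 0 0 A" "D W2 = SF g0 0 0 E" "D W3 = SF 0 h1 h2 0"
  shows "vf D (SF f f1 f2 f12) =
    SF (f0 * f1 + g0 * f2) (h1 * fps_deriv f - g0 * f12) (h2 * fps_deriv f + f0 * f12)
      (A * f1 + E * f2 + h1 * fps_deriv f2 - h2 * fps_deriv f1)"
  by (simp add: vf_def assms algebra_simps)

lemma codifferential_d_inf: "codifferential (d_inf m :: 'k::field_char_0 L)"
proof -
  have *: "coef (d_inf m :: 'k L) W1 = SF 0 0 0 (fps_X ^ m)" "coef (d_inf m :: 'k L) W2 = SF 0 0 0 0"
    "coef (d_inf m :: 'k L) W3 = SF 0 0 0 0"
    by (simp_all add: coef_d_inf)
  have "vf (coef (d_inf m)) (coef (d_inf m :: 'k L) j) = SF 0 0 0 0" for j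
    by (cases j) (simp_all add: * vf_odd [OF *])
  then show ?thesis
    by (simp add: codifferential_iff square_zero_iff lin_d_inf has_parity_odd_iff *)
qed

lemma codifferential_d_fam: "codifferential (d_fam m n a :: 'k::field_char_0 L)"
proof -
  have *: "coef (d_fam m n a :: 'k L) W1 = SF 0 0 0 (fps_X ^ m)" "coef (d_fam m n a :: 'k L) W2 = SF 0 0 0 0"
    "coef (d_fam m n a :: 'k L) W3 = SF 0 0 (fam_series m n a) 0"
    by (simp_all add: coef_d_fam)
  have "vf (coef (d_fam m n a)) (coef (d_fam m n a :: 'k L) j) = SF 0 0 0 0" for j
    by (cases j) (simp_all add: * vf_odd [OF *])
  then show ?thesis
    by (simp add: codifferential_iff square_zero_iff lin_d_fam has_parity_odd_iff *)
qed

text \<open>The two additional terms have degrees \<open>n + 2\<close> and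
  \<open>2 * n - m + 2\<close>, both above \<open>m + 2\<close> because
  \<open>n > m\<close>.\<close>

lemma is_extension_d_fam:
  assumes "n > m"
  shows "is_extension (m + 2) (d_inf m) (d_fam m n a :: 'k::field_char_0 L)"
proof -
  have deg: "mdeg (MI (0, 1, Suc i)) = i + 2" "mdeg (MI (1, 1, m)) = m + 2" for i
    by simp_all
  have fam: "d_fam m n a (vec I) = d_inf m (vec I)" if "mdeg I \<le> m + 2" for I
  proof -
    have "I \<noteq> MI (0, 1, Suc n)" "I \<noteq> MI (0, 1, Suc (2 * n - m))"
      using that assms deg by fastforce+
    then show ?thesis by (simp add: d_fam_def d_inf_def phi_vec)
  qed
  have inf: "d_inf m (vec I) = (0 :: 'k W)" if "mdeg I \<noteq> m + 2" for I
    using that deg(2) by (auto simp: d_inf_def phi_vec)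
  have "deg_comp k (d_fam m n a :: 'k L) = (\<lambda>x. 0)" if "k < m + 2" for k
    unfolding deg_comp_eq_iff [OF lin_d_fam lin_zero_map] using that fam inf by simp
  moreover have "deg_comp (m + 2) (d_fam m n a :: 'k L) = d_inf m"
    unfolding deg_comp_eq_iff [OF lin_d_fam lin_d_inf] using fam inf by simp
  moreover have "deg_comp (m + 2) (d_inf m :: 'k L) = d_inf m"
    unfolding deg_comp_eq_iff [OF lin_d_inf lin_d_inf] using inf by simp
  ultimately show ?thesis
    unfolding is_extension_def using codifferential_d_inf codifferential_d_fam by blast
qed

text \<open>Up to degree \<open>m + 2\<close> only t1 t2 x^m d/dt1 survives. The bounds differ
  because degree exceeds the exponent of x by the number of odd variables: none for f0 and g0, one
  for h1 and h2, two for A and E.\<close>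

lemma extension_coef:
  fixes d :: "'k::field_char_0 L"
  assumes "is_extension (m + 2) (d_inf m) d"
  obtains f0 g0 A E h1 h2 where "coef d W1 = SF f0 0 0 A" "coef d W2 = SF g0 0 0 E" "coef d W3 = SF 0 h1 h2 0"
    "\<And>i. i < m + 3 \<Longrightarrow> fps_nth f0 i = 0" "\<And>i. i < m + 3 \<Longrightarrow> fps_nth g0 i = 0"
    "\<And>i. i < m \<Longrightarrow> fps_nth A i = 0" "fps_nth A m = 1" "\<And>i. i < m + 1 \<Longrightarrow> fps_nth E i = 0"
    "\<And>i. i < m + 2 \<Longrightarrow> fps_nth h1 i = 0" "\<And>i. i < m + 2 \<Longrightarrow> fps_nth h2 i = 0"
proof -
  have cod: "codifferential d" using assms by (simp add: is_extension_def)
  then have lin: "lin d" and par: "has_parity mpar gpar 1 d" by (auto simp: codifferential_def)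
  have "deg_comp (mdeg I) d = (\<lambda>x. 0)" if "mdeg I < m + 2" for I
    using assms that by (simp add: is_extension_def)
  then have low: "d (vec I) = 0" if "mdeg I < m + 2" for I
    using that deg_comp_eq_iff [OF lin lin_zero_map, of "mdeg I"] by (metis (no_types, lifting))
  have "deg_comp (m + 2) d = d_inf m" using assms by (simp add: is_extension_def)
  then have eqd: "d (vec I) = d_inf m (vec I)" if "mdeg I = m + 2" for I
    using that deg_comp_vec [OF lin, of "m + 2" I] by simp
  have low': "d (vec I) = 0" if "mdeg I \<le> m + 2" "I \<noteq> MI (1, 1, m)" for I
    using that low [of I] eqd [of I] by (cases "mdeg I = m + 2") (simp_all add: d_inf_def phi_vec)
  have ne: "MI (0, 0, Suc i) \<noteq> MI (1, 1, m)" "MI (1, 0, i) \<noteq> MI (1, 1, m)" "MI (0, 1, i) \<noteq> MI (1, 1, m)" for i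
    by (simp_all add: MI_eq_iff)
  have a0: "fps_nth (c00 (coef d j)) i = 0" if "i < m + 3" for i j
  proof (cases i)
    case (Suc i')
    with that low' [of "MI (0, 0, Suc i')"] ne(1) show ?thesis
      by (simp add: coef_def sf_of_def del: fact_Suc)
  qed simp
  have a1: "fps_nth (c10 (coef d j)) i = 0" if "i < m + 2" for i j
    using that low' [of "MI (1, 0, i)"] ne(2) by (simp add: coef_def sf_of_def)
  have a2: "fps_nth (c01 (coef d j)) i = 0" if "i < m + 2" for i j
    using that low' [of "MI (0, 1, i)"] ne(3) by (simp add: coef_def sf_of_def)
  have a: "fps_nth (c11 (coef d j)) i = 0" if "i < m" for i j
    using that low [of "MI (1, 1, i)"] by (simp add: coef_def sf_of_def)
  have b: "fps_nth (c11 (coef d j)) m = (if j = W1 then 1 else 0)" for j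
    using eqd [of "MI (1, 1, m)"]
    by (simp add: coef_def sf_of_def d_inf_def phi_vec mfact_def lookup_single)
  have par': "c10 (coef d W1) = 0" "c01 (coef d W1) = 0" "c10 (coef d W2) = 0" "c01 (coef d W2) = 0"
    "c00 (coef d W3) = 0" "c11 (coef d W3) = 0"
    using par by (simp_all add: has_parity_odd_iff [OF lin])
  show ?thesis
  proof (rule that)
    show "coef d W1 = SF (c00 (coef d W1)) 0 0 (c11 (coef d W1))"
      "coef d W2 = SF (c00 (coef d W2)) 0 0 (c11 (coef d W2))"
      "coef d W3 = SF 0 (c10 (coef d W3)) (c01 (coef d W3)) 0"
      using par' by (simp_all add: sf.expand)
    show "fps_nth (c11 (coef d W1)) m = 1" by (simp add: b)
    show "fps_nth (c11 (coef d W2)) i = 0" if "i < m + 1" for i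
      using that a b by (cases "i = m") auto
  qed (use a0 a1 a2 a in auto)
qed

section \<open>Coordinate changes as coalgebra automorphisms\<close>

definition dual :: "mindex \<Rightarrow> 'k::field_char_0 sf" where
  "dual J = sf_of (\<lambda>I. if I = J then 1 else 0)"

definition sf_transpose :: "('k::field_char_0 sf \<Rightarrow> 'k sf) \<Rightarrow> 'k S \<Rightarrow> 'k S" where
  "sf_transpose T = lin_ext (\<lambda>I. \<Sum>J\<in>{J. mdeg J \<le> mdeg I}. cf (T (dual J)) I *\<^sub>v vec J)"

lemma finite_mdeg_le: "finite {J. mdeg J \<le> N}"
proof (rule finite_imageD)
  have "exps ` {J. mdeg J \<le> N} \<subseteq> {..N} \<times> {..N} \<times> {..N}"
  proof
    fix e assume "e \<in> exps ` {J. mdeg J \<le> N}"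
    then show "e \<in> {..N} \<times> {..N} \<times> {..N}"
      by (cases e) (auto simp: mdeg_def dest: sym)
  qed
  then show "finite (exps ` {J. mdeg J \<le> N})" by (rule finite_subset) simp
  show "inj_on exps {J. mdeg J \<le> N}" by (simp add: inj_on_def exps_inject)
qed

text \<open>By \<open>tri\<close> the coefficient of \<open>T F\<close> at \<open>I\<close> depends
  only on the part of \<open>F\<close> of degree at most \<open>mdeg I\<close>, a finite combination
  of the functions \<open>dual J\<close>. Hence the cutoff in \<open>sf_transpose\<close> loses
  nothing.\<close>

lemma ev_sf_transpose:
  fixes T :: "'k::field_char_0 sf \<Rightarrow> 'k sf"
  assumes add: "\<And>F H. T (sf_add F H) = sf_add (T F) (T H)"
    and scale: "\<And>r F. T (sf_scale r F) = sf_scale r (T F)"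
    and tri: "\<And>F I. (\<And>J. mdeg J \<le> mdeg I \<Longrightarrow> cf F J = 0) \<Longrightarrow> cf (T F) I = 0"
  shows "ev (cf F) (sf_transpose T x) = ev (cf (T F)) x"
proof -
  have "(\<Sum>J\<in>{J. mdeg J \<le> mdeg I}. cf (T (dual J)) I * cf F J) = cf (T F) I" for I
  proof -
    let ?R = "\<lambda>A. sf_of (\<lambda>J. if J \<in> A then cf F J else 0)"
    have R: "cf (T (?R A)) I = (\<Sum>J\<in>A. cf (T (dual J)) I * cf F J)" if "finite A" for A
      using that
    proof (induction A)
      case empty
      then show ?case using tri [of I "?R {}"] by simp
    next
      case (insert K A)
      have "?R (insert K A) = sf_add (?R A) (sf_scale (cf F K) (dual K))"
      proof (rule cf_eqI)
        show "cf (?R (insert K A)) = cf (sf_add (?R A) (sf_scale (cf F K) (dual K)))"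
          using insert.hyps by (auto simp: dual_def fun_eq_iff)
      qed (simp add: sf_of_def dual_def)
      then show ?case using insert by (simp add: add scale algebra_simps)
    qed
    let ?A = "{J. mdeg J \<le> mdeg I}"
    let ?D = "sf_add F (sf_scale (- 1) (?R ?A))"
    have "cf (T ?D) I = 0" by (rule tri) simp
    then show ?thesis using R [OF finite_mdeg_le] by (simp add: add scale)
  qed
  then show ?thesis by (simp add: sf_transpose_def ev_sum)
qed

text \<open>
  The coordinate change \<open>x \<mapsto> Z\<close>, \<open>\<theta>\<^sub>1 \<mapsto> v \<theta>\<^sub>1\<close>, \<open>\<theta>\<^sub>2 \<mapsto> u \<theta>\<^sub>2 + q \<theta>\<^sub>1\<close>.
\<close>

fun sf_subst :: "'k::field fps \<Rightarrow> 'k fps \<Rightarrow> 'k fps \<Rightarrow> 'k fps \<Rightarrow> 'k sf \<Rightarrow> 'k sf" where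
  "sf_subst Z v u q (SF f f1 f2 f12) =
    SF (f oo Z) ((f1 oo Z) * v + (f2 oo Z) * q) ((f2 oo Z) * u) ((f12 oo Z) * (v * u))"

lemma fps_compose_const_mult: "(fps_const r * f) oo Z = fps_const r * (f oo Z)" for f :: "'k::field fps"
  by (rule fps_ext) (simp add: fps_compose_nth sum_distrib_left mult.assoc)

lemma sf_subst_add: "sf_subst Z v u q (sf_add F H) = sf_add (sf_subst Z v u q F) (sf_subst Z v u q H)"
  by (cases F; cases H) (simp add: fps_compose_add_distrib algebra_simps)

lemma sf_subst_scale: "sf_subst Z v u q (sf_scale r F) = sf_scale r (sf_subst Z v u q F)"
  by (cases F) (simp add: fps_compose_const_mult distrib_left mult.assoc)

lemma sf_subst_mult:
  assumes "fps_nth Z 0 = 0"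
  shows "sf_subst Z v u q (sf_mult F H) = sf_mult (sf_subst Z v u q F) (sf_subst Z v u q H)"
  by (cases F; cases H)
    (simp add: fps_compose_add_distrib fps_compose_sub_distrib fps_compose_mult_distrib [OF assms] algebra_simps)

text \<open>\<open>Z\<close> has order at least one, so composition does not lower the order in x,
  and t1, t2 are replaced by linear combinations of t1, t2, so the number of odd variables is
  kept.\<close>

lemma sf_subst_tri:
  fixes F :: "'k::field_char_0 sf"
  assumes "fps_nth Z 0 = 0" "\<And>J. mdeg J \<le> mdeg I \<Longrightarrow> cf F J = 0"
  shows "cf (sf_subst Z v u q F) I = 0"
proof -
  obtain f f1 f2 f12 where F: "F = SF f f1 f2 f12" using sf.exhaust by metis
  have comp: "fps_nth (g oo Z) i = 0" if "\<And>j. j \<le> n \<Longrightarrow> fps_nth g j = 0" "i \<le> n" for g :: "'k fps" and i n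
    using that by (simp add: fps_compose_nth)
  have mult: "fps_nth ((g oo Z) * h) n = 0" if "\<And>j. j \<le> n \<Longrightarrow> fps_nth g j = 0" for g h :: "'k fps" and n
    unfolding fps_mult_nth by (rule sum.neutral) (simp add: comp [OF that])
  have f0: "fps_nth f (Suc n) = 0" if "Suc n \<le> mdeg I" for n
    using assms(2) [of "MI (0, 0, Suc n)"] that by (simp add: F cf_def del: fact_Suc)
  have f1: "fps_nth f1 n = 0" "fps_nth f2 n = 0" if "Suc n \<le> mdeg I" for n
    using assms(2) [of "MI (1, 0, n)"] assms(2) [of "MI (0, 1, n)"] that by (simp_all add: F cf_def)
  have f12: "fps_nth f12 n = 0" if "Suc (Suc n) \<le> mdeg I" for n
    using assms(2) [of "MI (1, 1, n)"] that by (simp add: F cf_def)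
  show ?thesis
  proof (cases I rule: mindex_cases)
    case (even0 n)
    have "fps_nth (f oo Z) (Suc n) = (\<Sum>i\<in>{0..Suc n}. fps_nth f i * fps_nth (Z ^ i) (Suc n))"
      by (simp add: fps_compose_nth)
    also have "\<dots> = 0"
    \<comment> \<open>A constant term of \<open>f\<close>, invisible to \<open>cf\<close>, may enter
      at \<open>i = 0\<close>; it meets the coefficient of \<open>Z ^ 0 = 1\<close> at
      \<open>Suc n\<close>, which is 0.\<close>
    proof (rule sum.neutral, rule ballI)
      fix i assume "i \<in> {0..Suc n}"
      then show "fps_nth f i * fps_nth (Z ^ i) (Suc n) = 0"
        using f0 even0 by (cases i) auto
    qed
    finally show ?thesis by (simp add: even0 F cf_def)
  qed (use f1 f12 in \<open>simp_all add: F cf_def mult\<close>)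
qed

lemma ev_transpose_subst:
  fixes F :: "'k::field_char_0 sf"
  assumes "fps_nth Z 0 = 0"
  shows "ev (cf F) (sf_transpose (sf_subst Z v u q) x) = ev (cf (sf_subst Z v u q F)) x"
  by (rule ev_sf_transpose [OF sf_subst_add sf_subst_scale sf_subst_tri [OF assms]])

lemma sf_subst_subst:
  assumes "fps_nth Z 0 = 0" "fps_nth Z' 0 = 0"
  shows "sf_subst Z v u q (sf_subst Z' v' u' q' F) =
    sf_subst (Z' oo Z) ((v' oo Z) * v) ((u' oo Z) * u) ((u' oo Z) * q + (q' oo Z) * v) F"
  by (cases F)
    (simp add: fps_compose_add_distrib fps_compose_mult_distrib [OF assms(1)]
      fps_compose_assoc [OF assms] algebra_simps)

lemma sf_subst_id: "sf_subst fps_X 1 1 0 F = F"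
  by (cases F) simp

lemma cf_functional_eqI:
  assumes "\<And>F. ev (cf F) x = ev (cf F) y"
  shows "x = y"
  using assms [of "sf_of _"] by (intro ev_eqI) simp

lemma dual_parity:
  "mpar J = 0 \<Longrightarrow> c10 (dual J :: 'k::field_char_0 sf) = 0 \<and> c01 (dual J :: 'k sf) = 0"
  "mpar J = 1 \<Longrightarrow> c00 (dual J :: 'k::field_char_0 sf) = 0 \<and> c11 (dual J :: 'k sf) = 0"
proof -
  have mp: "mpar (MI (1, 0, n)) = 1" "mpar (MI (0, 1, n)) = 1" "mpar (MI (1, 1, n)) = 0" for n
    by simp_all
  show "c10 (dual J :: 'k sf) = 0 \<and> c01 (dual J :: 'k sf) = 0" if "mpar J = 0"
    using that mp by (auto simp: dual_def sf_of_def fps_eq_iff)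
  have "mpar (MI (0, 0, n)) = 0" if "n \<noteq> 0" for n
    using that by (cases n) simp_all
  then have "n = 0" if "mpar (MI (0, 0, n)) = 1" for n
    using that by (metis zero_neq_one)
  then show "c00 (dual J :: 'k sf) = 0 \<and> c11 (dual J :: 'k sf) = 0" if "mpar J = 1"
    using that mp by (auto simp: dual_def sf_of_def fps_eq_iff)
qed

text \<open>Multiplicativity of the substitution transposes to compatibility with
  \<open>comult\<close>, and the inverse substitution transposes to the inverse map.\<close>

lemma coalg_automorphism_transpose:
  fixes Z v u q Z' v' u' q' :: "'k::field_char_0 fps"
  defines "S \<equiv> sf_subst Z v u q" and "S' \<equiv> sf_subst Z' v' u' q'"
  assumes Z: "fps_nth Z 0 = 0" "fps_nth Z' 0 = 0"
    and inv: "\<And>F. S (S' F) = F" "\<And>F. S' (S F) = F"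
  shows "coalg_automorphism (sf_transpose S)"
    and "Hilbert_Choice.inv (sf_transpose S) = sf_transpose S'"
proof -
  let ?g = "sf_transpose S" and ?h = "sf_transpose S'"
  have ev: "ev (cf F) (?g x) = ev (cf (S F)) x" "ev (cf F) (?h x) = ev (cf (S' F)) x" for F x
    unfolding S_def S'_def by (rule ev_transpose_subst, rule Z)+
  have gh: "?g (?h x) = x" "?h (?g x) = x" for x
    by (rule cf_functional_eqI, simp add: ev inv)+
  show "Hilbert_Choice.inv ?g = ?h"
    using gh by (intro inv_equality)
  have "bij ?g" using gh by (metis bijI')
  moreover have lin: "lin ?g" unfolding sf_transpose_def by (rule lin_lin_ext)
  moreover have "has_parity mpar mpar 0 ?g"
    unfolding has_parity_iff [OF lin]
  proof (intro allI impI)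
    fix I J assume ne: "mpar J \<noteq> 0 + mpar I"
    have "Poly_Mapping.lookup (?g (vec I)) J = ev (cf (dual J)) (?g (vec I))"
      by (simp add: lookup_eq_ev dual_def)
    also have "\<dots> = cf (S (dual J)) I" by (simp add: ev)
    also have "\<dots> = 0"
    proof -
      obtain f f1 f2 f12 where F: "(dual J :: 'k sf) = SF f f1 f2 f12" using sf.exhaust by metis
      have "f1 = 0 \<and> f2 = 0" if "mpar J = 0" using dual_parity(1) [OF that, where 'k = 'k] F by simp
      moreover have "f = 0 \<and> f12 = 0" if "mpar J = 1" using dual_parity(2) [OF that, where 'k = 'k] F by simp
      ultimately show ?thesis using ne unfolding S_def F
        by (cases I rule: mindex_cases; cases "mpar J") (auto simp: cf_def)
    qed
    finally show "Poly_Mapping.lookup (?g (vec I)) J = 0" .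
  qed
  moreover have "comult (?g x) = tensor_map ?g ?g (comult x)" for x
  proof (rule ev_tensor_eqI)
    fix c c' :: "mindex \<Rightarrow> 'k"
    define F H where "F = sf_of c" and "H = sf_of c'"
    have c: "c = cf F" "c' = cf H" by (simp_all add: F_def H_def)
    have zero: "fps_nth (c00 F) 0 = 0" "fps_nth (c00 H) 0 = 0" by (simp_all add: F_def H_def)
    then have zero': "fps_nth (c00 (S F)) 0 = 0" "fps_nth (c00 (S H)) 0 = 0"
      by (cases F; cases H; simp add: S_def)+
    have "ev (\<lambda>p. cf F (fst p) * cf H (snd p)) (comult (?g x)) = ev (cf (S (sf_mult F H))) x"
      by (simp add: ev_comult zero ev)
    also have "\<dots> = ev (\<lambda>p. cf (S F) (fst p) * cf (S H) (snd p)) (comult x)"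
      unfolding ev_comult [OF zero'] by (simp add: S_def sf_subst_mult [OF Z(1)])
    also have "\<dots> = ev (\<lambda>p. cf F (fst p) * cf H (snd p)) (tensor_map ?g ?g (comult x))"
      by (simp add: ev_tensor_map ev)
    finally show "ev (\<lambda>p. c (fst p) * c' (snd p)) (comult (?g x)) =
        ev (\<lambda>p. c (fst p) * c' (snd p)) (tensor_map ?g ?g (comult x))"
      unfolding c .
  qed
  ultimately show "coalg_automorphism ?g" unfolding coalg_automorphism_def by blast
qed

text \<open>The hypothesis \<open>vf\<close> says Q S = S Q' for the substitution S. Since
  transposition reverses composition, the automorphism realising the equivalence is the transpose of
  the inverse of S.\<close>

lemma equivalent_substI:
  fixes d d' :: "'k::field_char_0 L"
  assumes lin: "lin d" "lin d'"
    and Z: "fps_nth Z 0 = 0" "fps_nth Z 1 \<noteq> 0" and unit: "fps_nth v 0 \<noteq> 0" "fps_nth u 0 \<noteq> 0"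
    and vf: "\<And>F. vf (coef d) (sf_subst Z v u q F) = sf_subst Z v u q (vf (coef d') F)"
  shows "equivalent d d'"
proof -
  define Y where "Y = fps_inv Z"
  have YZ: "Y oo Z = fps_X" "Z oo Y = fps_X"
    using Z by (simp_all add: Y_def fps_inv fps_inv_right)
  have Y0: "fps_nth Y 0 = 0" by (simp add: Y_def fps_inv_def)
  have vi: "v * inverse v = 1" and ui: "u * inverse u = 1"
    using unit by (simp_all add: inverse_mult_eq_1')
  \<comment> \<open>Found by solving for the identity in the composition formula
    \<open>sf_subst_subst\<close>.\<close>
  define v' u' q' where "v' = inverse v oo Y" and "u' = inverse u oo Y"
    and "q' = (- q * inverse u * inverse v) oo Y"
  define S S' where "S = sf_subst Z v u q" and "S' = sf_subst Y v' u' q'"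
  have cancel: "(f oo Y) oo Z = f" for f :: "'k fps"
    using fps_compose_assoc [OF Z(1) Y0, of f] by (simp add: YZ)
  have SS': "S (S' F) = F" for F
  proof -
    have "(v' oo Z) * v = 1" "(u' oo Z) * u = 1" "(u' oo Z) * q + (q' oo Z) * v = 0"
      using vi ui by (simp_all add: v'_def u'_def q'_def cancel algebra_simps)
    then show ?thesis
      by (simp add: S_def S'_def sf_subst_subst Z(1) Y0 YZ sf_subst_id)
  qed
  have S'S: "S' (S F) = F" for F
  proof -
    have [simp]: "(f oo Y) * (g oo Y) = (f * g) oo Y" for f g :: "'k fps"
      by (simp add: fps_compose_mult_distrib Y0)
    have "(v oo Y) * v' = 1" "(u oo Y) * u' = 1" "(u oo Y) * q' + (q oo Y) * v' = 0"
      using vi ui by (simp_all add: v'_def u'_def q'_def flip: fps_compose_add_distrib)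
        (simp add: mult.assoc [symmetric] mult.commute [of q])
    then show ?thesis
      by (simp add: S_def S'_def sf_subst_subst Z(1) Y0 YZ sf_subst_id)
  qed
  let ?g = "sf_transpose S'" and ?h = "sf_transpose S"
  have aut: "coalg_automorphism ?g"
    unfolding S'_def using S'S SS'
    by (intro coalg_automorphism_transpose(1) [OF Y0 Z(1)]) (simp_all add: S_def S'_def)
  have inv: "Hilbert_Choice.inv ?g = ?h"
    unfolding S_def S'_def using S'S SS'
    by (intro coalg_automorphism_transpose(2) [OF Y0 Z(1)]) (simp_all add: S_def S'_def)
  have "coder d' x = ?h (coder d (?g x))" for x
  proof (rule cf_functional_eqI)
    fix F
    have "ev (cf F) (?h (coder d (?g x))) = ev (cf (S' (vf (coef d) (S F)))) x"
      by (simp add: S_def S'_def ev_transpose_subst Z(1) Y0 ev_coder lin)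
    also have "vf (coef d) (S F) = S (vf (coef d') F)" unfolding S_def by (rule vf)
    finally show "ev (cf F) (coder d' x) = ev (cf F) (?h (coder d (?g x)))"
      by (simp add: S'S ev_coder lin)
  qed
  then show ?thesis
    unfolding equivalent_def using aut inv by (intro exI [of _ ?g]) (auto simp: fun_eq_iff)
qed

section \<open>Normal form of the associated one-form\<close>

lemma fps_X_power_dvd_iff: "fps_X ^ k dvd (f :: 'k::field fps) \<longleftrightarrow> (\<forall>i<k. fps_nth f i = 0)"
proof
  assume "\<forall>i<k. fps_nth f i = 0"
  then have "f = fps_X ^ k * fps_shift k f"
    by (intro fps_ext) (simp add: fps_X_power_mult_nth)
  then show "fps_X ^ k dvd f" by (metis dvd_triv_left)
qed (auto simp: dvd_def fps_X_power_mult_nth)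

lemma fps_X_power_dvd_deriv: "fps_X ^ Suc k dvd (f :: 'k::field fps) \<Longrightarrow> fps_X ^ k dvd fps_deriv f"
  unfolding fps_X_power_dvd_iff by simp

lemma fps_X_power_dvd_mult:
  "fps_X ^ i dvd (f :: 'k::field fps) \<Longrightarrow> fps_X ^ j dvd g \<Longrightarrow> k \<le> i + j \<Longrightarrow> fps_X ^ k dvd f * g"
  using mult_dvd_mono [of "fps_X ^ i" f "fps_X ^ j" g]
  by (intro dvd_trans [OF le_imp_power_dvd [of k "i + j" fps_X]]) (simp_all only: power_add)

lemma fps_X_power_dvd_le: "fps_X ^ i dvd (f :: 'k::field fps) \<Longrightarrow> k \<le> i \<Longrightarrow> fps_X ^ k dvd f"
  by (rule dvd_trans [OF le_imp_power_dvd])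

lemma fps_X_power_dvd_subdegree: "k \<le> subdegree f \<Longrightarrow> fps_X ^ k dvd (f :: 'k::field fps)"
  unfolding fps_X_power_dvd_iff by (intro allI impI nth_less_subdegree_zero) (rule less_le_trans)

lemma subdegree_ge_dvd: "f \<noteq> 0 \<Longrightarrow> fps_X ^ k dvd (f :: 'k::field fps) \<Longrightarrow> k \<le> subdegree f"
  unfolding fps_X_power_dvd_iff by (rule subdegree_geI) auto

text \<open>Orders add, so \<open>f * A\<close> has order at most \<open>k + m\<close>. This is how
  terms of too high order in Q^2 = 0 exclude a nonzero coefficient.\<close>

lemma fps_mult_order_contradiction:
  fixes f A :: "'k::field fps"
  assumes "f \<noteq> 0" "subdegree f \<le> k" "fps_X ^ m dvd A" "fps_nth A m \<noteq> 0" "fps_X ^ (k + m + 1) dvd f * A"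
  shows False
proof -
  have A: "A \<noteq> 0" "subdegree A = m"
    using assms(3,4) by (auto simp: fps_X_power_dvd_iff intro!: subdegreeI)
  have "fps_nth (f * A) (subdegree f + m) \<noteq> 0"
    using assms(1) A nth_subdegree_mult [of f A] assms(4) by simp
  then show False using assms(2) assms(5) [unfolded fps_X_power_dvd_iff] by simp
qed

text \<open>Algebraic closedness supplies a root of the constant coefficient; as that coefficient is
  nonzero, the power series root follows in characteristic zero.\<close>

lemma fps_nth_root_exists:
  fixes f :: "'k::{alg_closed_field, field_char_0} fps"
  assumes "p > 0" "fps_nth f 0 \<noteq> 0"
  obtains g where "g ^ p = f"
proof -
  obtain p' where p: "p = Suc p'" using assms(1) by (cases p) auto
  define r :: "nat \<Rightarrow> 'k \<Rightarrow> 'k" where "r = (\<lambda>n x. SOME y. y ^ n = x)"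
  have "r (Suc p') (fps_nth f 0) ^ Suc p' = fps_nth f 0"
    unfolding r_def by (rule someI_ex, rule nth_root_exists) simp
  then have "fps_radical r (Suc p') f ^ Suc p' = f"
    using power_radical [of f r p'] assms(2) by blast
  then show ?thesis using that p by blast
qed

lemma fps_deriv_inverse_power:
  fixes l \<kappa> :: "'k::field_char_0 fps"
  assumes "p > 0" and \<kappa>l: "\<kappa> * l ^ p = 1"
  shows "fps_deriv \<kappa> * l ^ (p + 1) = - (fps_const (of_nat p) * fps_deriv l)"
proof -
  obtain p' where p': "p = Suc p'" using assms(1) by (cases p) auto
  have dl: "fps_deriv (l ^ p) = fps_const (of_nat p) * fps_deriv l * l ^ p'"
    unfolding fps_deriv_power by (simp add: p')
  have "fps_deriv (\<kappa> * l ^ p) = 0" unfolding \<kappa>l by simp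
  then have "fps_deriv \<kappa> * l ^ p + \<kappa> * (fps_const (of_nat p) * fps_deriv l * l ^ p') = 0"
    unfolding fps_deriv_mult dl by (simp add: add.commute)
  then have "(fps_deriv \<kappa> * l ^ p + \<kappa> * (fps_const (of_nat p) * fps_deriv l * l ^ p')) * l = 0" by simp
  moreover have "(fps_deriv \<kappa> * l ^ p + \<kappa> * (fps_const (of_nat p) * fps_deriv l * l ^ p')) * l =
      fps_deriv \<kappa> * (l ^ p * l) + (\<kappa> * (l ^ p' * l)) * (fps_const (of_nat p) * fps_deriv l)"
    by (simp only: algebra_simps)
  moreover have "l ^ p' * l = l ^ p" "l ^ p * l = l ^ (p + 1)" by (simp_all add: p')
  ultimately have "fps_deriv \<kappa> * l ^ (p + 1) + (\<kappa> * l ^ p) * (fps_const (of_nat p) * fps_deriv l) = 0"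
    by simp
  then show ?thesis unfolding \<kappa>l by (simp add: eq_neg_iff_add_eq_0)
qed

text \<open>
  Up to a holomorphic summand, the form \<open>k dx / x\<^sup>p\<^sup>+\<^sup>1\<close> becomes
  \<open>dZ / (Z\<^sup>p\<^sup>+\<^sup>1 (1 + a Z\<^sup>p))\<close> in a suitable coordinate \<open>Z = x l\<close>, where \<open>- a\<close> is its residue;
  the factor \<open>\<kappa> = l\<^sup>-\<^sup>p\<close> integrates the remaining principal part.
\<close>

lemma normalize_form:
  fixes k :: "'k::{alg_closed_field, field_char_0} fps"
  assumes "p > 0" "fps_nth k 0 \<noteq> 0"
  obtains l \<nu> a K where "fps_nth l 0 \<noteq> 0" "fps_deriv (fps_X * l) = K * l ^ (p + 1)"
    "(1 + fps_const a * (fps_X * l) ^ p) * (k - fps_X ^ (p + 1) * \<nu>) = K"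
proof -
  \<comment> \<open>The principal part of k dx / x^(p+1) without the residue term.\<close>
  define K where "K = Abs_fps (\<lambda>i. if i < p then fps_nth k i else 0)"
  \<comment> \<open>Solves p \<kappa> - x \<kappa>' = p K coefficientwise, so that \<kappa> x^(-p)
    is -p times a primitive of K x^(-p-1). At \<open>i = p\<close> the quotient is 0 / 0 = 0, and
    the equation holds there because \<open>K\<close> has no coefficient at
    \<open>p\<close>.\<close>
  define \<kappa> where "\<kappa> = Abs_fps (\<lambda>i. of_nat p * fps_nth K i / (of_nat p - of_nat i))"
  define a where "a = - fps_nth k p"
  have p: "of_nat p \<noteq> (0 :: 'k)" using assms(1) by simp
  have \<kappa>0: "fps_nth \<kappa> 0 = fps_nth k 0" using assms(1) p by (simp add: \<kappa>_def K_def)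
  obtain h where h: "h ^ p = \<kappa>" using fps_nth_root_exists [OF assms(1), of \<kappa>] \<kappa>0 assms(2) by auto
  have h0: "fps_nth h 0 \<noteq> 0"
  proof
    assume "fps_nth h 0 = 0"
    then have "fps_nth (h ^ p) 0 = 0" using assms(1) by (simp add: fps_power_zeroth)
    then show False using h \<kappa>0 assms(2) by simp
  qed
  \<comment> \<open>With Z = x l this means Z^(-p) = \<kappa> x^(-p).\<close>
  define l where "l = inverse h"
  have hl: "h * l = 1" using h0 by (simp add: l_def inverse_mult_eq_1')
  have \<kappa>l: "\<kappa> * l ^ p = 1" using hl by (simp flip: h power_mult_distrib)
  have l0: "fps_nth l 0 \<noteq> 0" using h0 by (simp add: l_def)
  have \<kappa>_eq: "fps_const (of_nat p) * \<kappa> - fps_X * fps_deriv \<kappa> = fps_const (of_nat p) * K"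
  proof (rule fps_ext)
    fix i
    have "(of_nat p - of_nat i) * fps_nth \<kappa> i = of_nat p * fps_nth K i"
      by (cases "i = p") (simp_all add: \<kappa>_def K_def)
    then show "fps_nth (fps_const (of_nat p) * \<kappa> - fps_X * fps_deriv \<kappa>) i = fps_nth (fps_const (of_nat p) * K) i"
      by (cases i) (simp_all add: algebra_simps)
  qed
  have d\<kappa>: "fps_deriv \<kappa> * l ^ (p + 1) = - (fps_const (of_nat p) * fps_deriv l)"
    by (rule fps_deriv_inverse_power [OF assms(1) \<kappa>l])
  have dZ: "fps_deriv (fps_X * l) = K * l ^ (p + 1)"
  proof -
    have "fps_const (of_nat p) * (K * l ^ (p + 1)) = (fps_const (of_nat p) * \<kappa> - fps_X * fps_deriv \<kappa>) * l ^ (p + 1)"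
      unfolding \<kappa>_eq by (simp add: mult.assoc)
    also have "\<dots> = fps_const (of_nat p) * ((\<kappa> * l ^ p) * l) - fps_X * (fps_deriv \<kappa> * l ^ (p + 1))"
      by (simp add: algebra_simps)
    also have "\<dots> = fps_const (of_nat p) * (l + fps_X * fps_deriv l)"
      unfolding \<kappa>l d\<kappa> by (simp add: algebra_simps)
    finally have "K * l ^ (p + 1) = l + fps_X * fps_deriv l"
      using p by (simp only: mult_cancel_left fps_const_eq_0_iff simp_thms)
    then show ?thesis by (simp add: algebra_simps)
  qed
  define \<omega> where "\<omega> = 1 + fps_const a * (fps_X * l) ^ p"
  have \<omega>_eq: "\<omega> = 1 + fps_X ^ p * (fps_const a * l ^ p)"
    by (simp add: \<omega>_def power_mult_distrib algebra_simps)
  have \<omega>0: "fps_nth \<omega> 0 = 1" using assms(1) by (simp add: \<omega>_eq fps_X_power_mult_nth)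
  \<comment> \<open>Below order p both \<open>\<omega> * k\<close> and \<open>K\<close> agree with
    \<open>k\<close>. At order p the difference is \<open>fps_nth k p + a\<close>, since
    \<open>l ^ p * k\<close> has constant coefficient 1; this dictates \<open>a\<close>.\<close>
  have "fps_X ^ (p + 1) dvd \<omega> * k - K"
    unfolding fps_X_power_dvd_iff
  proof (intro allI impI)
    fix i assume "i < p + 1"
    have c: "\<omega> * k - K = k + fps_X ^ p * (fps_const a * (l ^ p * k)) - K"
      by (simp add: \<omega>_eq algebra_simps)
    have "fps_nth (\<kappa> * l ^ p) 0 = 1" unfolding \<kappa>l by simp
    then have "fps_nth (l ^ p * k) 0 = 1" using \<kappa>0 by (simp add: mult.commute)
    moreover have "i < p \<or> i = p" using \<open>i < p + 1\<close> by auto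
    ultimately show "fps_nth (\<omega> * k - K) i = 0"
      unfolding c by (auto simp: fps_X_power_mult_nth K_def a_def)
  qed
  then obtain \<rho> where \<rho>: "\<omega> * k - K = fps_X ^ (p + 1) * \<rho>" by (rule dvdE)
  have "\<omega> * inverse \<omega> = 1" using \<omega>0 by (simp add: inverse_mult_eq_1')
  moreover have "\<omega> * (k - fps_X ^ (p + 1) * (\<rho> * inverse \<omega>)) = \<omega> * k - fps_X ^ (p + 1) * \<rho> * (\<omega> * inverse \<omega>)"
    by (simp add: algebra_simps)
  moreover have "\<omega> * k - fps_X ^ (p + 1) * \<rho> = K" unfolding \<rho> [symmetric] by simp
  ultimately have "\<omega> * (k - fps_X ^ (p + 1) * (\<rho> * inverse \<omega>)) = K" by (simp del: power_Suc)
  then show ?thesis using that l0 dZ unfolding \<omega>_def by blast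
qed

text \<open>\<open>v\<close> is the exponential of a primitive of \<open>\<nu>\<close>; rescaling t1
  by it absorbs the holomorphic part of the form.\<close>

lemma log_derivative_exists:
  fixes \<nu> :: "'k::field_char_0 fps"
  obtains v where "fps_nth v 0 \<noteq> 0" "fps_deriv v = \<nu> * v"
proof -
  define I where "I = fps_integral0 \<nu>"
  have I0: "fps_nth I 0 = 0" and dI: "fps_deriv I = \<nu>"
    by (simp_all add: I_def fps_deriv_fps_integral)
  have "fps_deriv (fps_exp 1 oo I) = \<nu> * (fps_exp 1 oo I)"
    by (simp add: fps_compose_deriv [OF I0] dI mult.commute)
  moreover have "fps_nth (fps_exp (1::'k) oo I) 0 \<noteq> 0" by simp
  ultimately show ?thesis using that by blast
qed

text \<open>The hypotheses are what intertwining demands on coordinates: those named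
  \<open>u\<close> and \<open>q\<close> come from x, \<open>v\<close> from t1 and \<open>qu\<close>
  from t2. In addition, \<open>uq\<close> cancels the terms with the derivative of the t2
  coefficient of \<open>F\<close>.\<close>

lemma vf_sf_subst:
  assumes D: "D W1 = SF 0 0 0 A" "D W2 = SF 0 0 0 E" "D W3 = SF 0 h1 h2 0"
    and D': "D' W1 = SF 0 0 0 (fps_X ^ m)" "D' W2 = SF 0 0 0 0" "D' W3 = SF 0 0 B 0"
    and Z: "fps_nth Z 0 = 0"
    and u: "(B oo Z) * u = h2 * fps_deriv Z" and q: "(B oo Z) * q = h1 * fps_deriv Z"
    and v: "A * v - h2 * fps_deriv v = Z ^ m * v * u"
    and qu: "A * q + E * u + h1 * fps_deriv u - h2 * fps_deriv q = 0" and uq: "h1 * u = h2 * q"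
  shows "vf D (sf_subst Z v u q F) = sf_subst Z v u q (vf D' F)"
proof -
  obtain f f1 f2 f12 where F: "F = SF f f1 f2 f12" using sf.exhaust by metis
  define c c1 c2 d d1 d2 where defs: "c = f oo Z" "c1 = f1 oo Z" "c2 = f2 oo Z"
    "d = fps_deriv f oo Z" "d1 = fps_deriv f1 oo Z" "d2 = fps_deriv f2 oo Z"
  have deriv: "fps_deriv c = d * fps_deriv Z" "fps_deriv c1 = d1 * fps_deriv Z" "fps_deriv c2 = d2 * fps_deriv Z"
    unfolding defs by (rule fps_compose_deriv [OF Z])+
  have "A * (c1 * v + c2 * q) + E * (c2 * u) + h1 * fps_deriv (c2 * u) - h2 * fps_deriv (c1 * v + c2 * q)
      = c1 * (A * v - h2 * fps_deriv v) + c2 * (A * q + E * u + h1 * fps_deriv u - h2 * fps_deriv q)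
        + d2 * fps_deriv Z * (h1 * u - h2 * q) - d1 * v * (h2 * fps_deriv Z)"
    by (simp add: deriv algebra_simps)
  also have "\<dots> = (Z ^ m * c1 - (B oo Z) * d1) * (v * u)"
    unfolding v qu uq u [symmetric] by (simp add: algebra_simps)
  finally have 11: "A * (c1 * v + c2 * q) + E * (c2 * u) + h1 * fps_deriv (c2 * u) - h2 * fps_deriv (c1 * v + c2 * q)
      = (Z ^ m * c1 - (B oo Z) * d1) * (v * u)" .
  have 10: "h1 * fps_deriv c = (B oo Z) * d * q"
    by (simp add: deriv mult.left_commute [of h1] mult.assoc mult.left_commute [of _ d] flip: q)
  have 01: "h2 * fps_deriv c = (B oo Z) * d * u"
    by (simp add: deriv mult.left_commute [of h2] mult.assoc mult.left_commute [of _ d] flip: u)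
  have L: "vf D (sf_subst Z v u q F) = SF 0 ((B oo Z) * d * q) ((B oo Z) * d * u) ((Z ^ m * c1 - (B oo Z) * d1) * (v * u))"
    unfolding F sf_subst.simps vf_odd [OF D] defs [symmetric] 11 10 01 by simp
  have R: "sf_subst Z v u q (vf D' F) = SF 0 ((B oo Z) * d * q) ((B oo Z) * d * u) ((Z ^ m * c1 - (B oo Z) * d1) * (v * u))"
    unfolding F sf_subst.simps vf_odd [OF D'] defs
    by (simp add: fps_compose_mult_distrib [OF Z] fps_compose_sub_distrib fps_X_power_compose [OF Z])
  show ?thesis unfolding L R ..
qed

section \<open>Classification of the extensions\<close>

text \<open>One component of Q^2 = 0 reads f0 A = -h2 f0'. For f0 of order k the left side has order
  k + m and the right side at least (m + 2) + (k - 1), so f0 = 0; then g0 A = h1 f0' = 0.\<close>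

lemma extension_normal_shape:
  fixes d :: "'k::field_char_0 L"
  assumes "is_extension (m + 2) (d_inf m) d"
  obtains A E h1 h2 where "coef d W1 = SF 0 0 0 A" "coef d W2 = SF 0 0 0 E" "coef d W3 = SF 0 h1 h2 0"
    "A * h1 + E * h2 + h1 * fps_deriv h2 - h2 * fps_deriv h1 = 0"
    "fps_X ^ m dvd A" "fps_nth A m = 1" "fps_X ^ (m + 1) dvd E" "fps_X ^ (m + 2) dvd h1" "fps_X ^ (m + 2) dvd h2"
proof -
  obtain f0 g0 A E h1 h2 where D: "coef d W1 = SF f0 0 0 A" "coef d W2 = SF g0 0 0 E" "coef d W3 = SF 0 h1 h2 0"
    and ord: "\<And>i. i < m + 3 \<Longrightarrow> fps_nth f0 i = 0" "\<And>i. i < m + 3 \<Longrightarrow> fps_nth g0 i = 0"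
    "\<And>i. i < m \<Longrightarrow> fps_nth A i = 0" "fps_nth A m = 1" "\<And>i. i < m + 1 \<Longrightarrow> fps_nth E i = 0"
    "\<And>i. i < m + 2 \<Longrightarrow> fps_nth h1 i = 0" "\<And>i. i < m + 2 \<Longrightarrow> fps_nth h2 i = 0"
    by (rule extension_coef [OF assms]) blast
  have dvd: "fps_X ^ m dvd A" "fps_X ^ (m + 1) dvd E" "fps_X ^ (m + 2) dvd h1" "fps_X ^ (m + 2) dvd h2"
    using ord unfolding fps_X_power_dvd_iff by blast+
  have "codifferential d" using assms by (simp add: is_extension_def)
  then have sq: "vf (coef d) (coef d j) = SF 0 0 0 0" for j
    using square_zero_iff [of d] by (simp add: codifferential_iff)
  have s1: "h1 * fps_deriv f0 - g0 * A = 0" "h2 * fps_deriv f0 + f0 * A = 0"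
    using sq [of W1] unfolding D(1) vf_odd [OF D] by simp_all
  have s3: "A * h1 + E * h2 + h1 * fps_deriv h2 - h2 * fps_deriv h1 = 0"
    using sq [of W3] unfolding D(3) vf_odd [OF D] by simp
  have f0: "f0 = 0"
  proof (rule ccontr)
    assume ne: "f0 \<noteq> 0"
    define k where "k = subdegree f0"
    have k: "m + 3 \<le> k" unfolding k_def by (rule subdegree_geI [OF ne]) (use ord(1) in auto)
    define k' where "k' = k - 1"
    have k': "k = Suc k'" using k by (simp add: k'_def)
    have "fps_X ^ k dvd f0" unfolding k_def by (rule fps_X_power_dvd_subdegree) simp
    then have "fps_X ^ k' dvd fps_deriv f0" unfolding k' by (rule fps_X_power_dvd_deriv)
    then have "fps_X ^ (k + m + 1) dvd h2 * fps_deriv f0"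
      by (rule fps_X_power_dvd_mult [OF dvd(4)]) (simp add: k')
    moreover have "f0 * A = - (h2 * fps_deriv f0)" using s1(2) by (simp add: eq_neg_iff_add_eq_0 add.commute)
    ultimately have "fps_X ^ (k + m + 1) dvd f0 * A" by simp
    then show False
      using fps_mult_order_contradiction [OF ne, of k m A] dvd(1) ord(4) by (simp add: k_def)
  qed
  moreover have "A \<noteq> 0" using ord(4) by auto
  ultimately have "g0 = 0" using s1(1) by simp
  with f0 D s3 dvd ord(4) that show ?thesis by blast
qed

text \<open>If h1 had smaller order k than h2, all terms of \<open>eq\<close> except A h1 would have
  order at least k + m + 1, while A h1 has order k + m. The divisibility allows a change of t2 by a
  multiple of t1 to absorb h1.\<close>

lemma extension_h1_dvd:
  fixes A E h1 h2 :: "'k::field_char_0 fps"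
  assumes eq: "A * h1 + E * h2 + h1 * fps_deriv h2 - h2 * fps_deriv h1 = 0"
    and dvd: "fps_X ^ m dvd A" "fps_X ^ (m + 1) dvd E" "fps_X ^ (m + 2) dvd h1" "fps_X ^ (m + 2) dvd h2"
    and A: "fps_nth A m = 1" and "h2 \<noteq> 0"
  shows "fps_X ^ subdegree h2 dvd h1"
proof (cases "h1 = 0")
  case False
  define k l where "k = subdegree h1" and "l = subdegree h2"
  have kl: "fps_X ^ k dvd h1" "fps_X ^ l dvd h2"
    unfolding k_def l_def by (rule fps_X_power_dvd_subdegree, simp)+
  have "m + 2 \<le> k" "m + 2 \<le> l"
    unfolding k_def l_def using dvd(3,4) False \<open>h2 \<noteq> 0\<close> subdegree_ge_dvd by blast+
  define k' l' where "k' = k - 1" and "l' = l - 1"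
  have k': "k = Suc k'" "m < k'" and l': "l = Suc l'" "m < l'"
    using \<open>m + 2 \<le> k\<close> \<open>m + 2 \<le> l\<close> by (simp_all add: k'_def l'_def)
  have "l \<le> k"
  proof (rule ccontr)
    assume "\<not> l \<le> k"
    then have lk: "k \<le> l" by simp
    have "fps_X ^ k' dvd fps_deriv h1" "fps_X ^ l' dvd fps_deriv h2"
      using kl unfolding k'(1) l'(1) by (simp_all only: fps_X_power_dvd_deriv)
    note d = this
    have "fps_X ^ (k + m + 1) dvd h2 * E"
      by (rule fps_X_power_dvd_mult [OF kl(2) dvd(2)]) (use lk in simp)
    moreover have "fps_X ^ (k + m + 1) dvd h1 * fps_deriv h2"
      by (rule fps_X_power_dvd_mult [OF kl(1) d(2)]) (use l' in simp)
    moreover have "fps_X ^ (k + m + 1) dvd h2 * fps_deriv h1"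
      by (rule fps_X_power_dvd_mult [OF kl(2) d(1)]) (use k' l' lk in simp)
    ultimately have "fps_X ^ (k + m + 1) dvd h2 * fps_deriv h1 - h1 * fps_deriv h2 - h2 * E"
      by (intro dvd_diff)
    moreover have "h1 * A = h2 * fps_deriv h1 - h1 * fps_deriv h2 - h2 * E"
      using eq by (simp add: algebra_simps)
    ultimately have "fps_X ^ (k + m + 1) dvd h1 * A" by simp
    then show False
      using fps_mult_order_contradiction [OF False, of k m A] dvd(1) A by (simp add: k_def)
  qed
  then show ?thesis using kl(1) fps_X_power_dvd_le unfolding l_def by blast
qed simp

text \<open>With Z = x and v = 1 the intertwining conditions reduce to A = x^m u and A q + E u = 0,
  solved by q = -E / x^m.\<close>

lemma equivalent_d_inf:
  fixes d :: "'k::field_char_0 L"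
  assumes lin: "lin d" and D: "coef d W1 = SF 0 0 0 A" "coef d W2 = SF 0 0 0 E" "coef d W3 = SF 0 0 0 0"
    and dvd: "fps_X ^ m dvd A" "fps_X ^ (m + 1) dvd E" and A: "fps_nth A m = 1"
  shows "equivalent d (d_inf m)"
proof -
  obtain u where u: "A = fps_X ^ m * u" using dvd(1) by (rule dvdE)
  obtain e where e: "E = fps_X ^ m * e"
    using fps_X_power_dvd_le [OF dvd(2), of m] by (auto elim: dvdE)
  have u0: "fps_nth u 0 = 1" using A unfolding u by (simp add: fps_X_power_mult_nth)
  have inf: "coef (d_inf m :: 'k L) W1 = SF 0 0 0 (fps_X ^ m)" "coef (d_inf m :: 'k L) W2 = SF 0 0 0 0"
    "coef (d_inf m :: 'k L) W3 = SF 0 0 0 0"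
    by (simp_all add: coef_d_inf)
  show ?thesis
  proof (rule equivalent_substI [OF lin lin_d_inf])
    show "fps_nth fps_X 0 = (0 :: 'k)" "fps_nth fps_X 1 \<noteq> (0 :: 'k)" "fps_nth (1 :: 'k fps) 0 \<noteq> 0"
      "fps_nth u 0 \<noteq> 0" by (simp_all add: u0)
    show "vf (coef d) (sf_subst fps_X 1 u (- e) F) = sf_subst fps_X 1 u (- e) (vf (coef (d_inf m)) F)" for F
      by (rule vf_sf_subst [OF D inf]) (simp_all add: u e algebra_simps)
  qed
qed

lemma fam_series_compose:
  assumes "fps_nth Z 0 = 0" "m < n"
  shows "fam_series m n a oo Z = Z ^ (n + 1) * (1 + fps_const a * Z ^ (n - m))"
proof -
  have "2 * n - m + 1 = (n + 1) + (n - m)" using assms(2) by simp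
  then have "fam_series m n a oo Z = Z ^ (n + 1) + fps_const a * Z ^ ((n + 1) + (n - m))"
    unfolding fam_series_def
    by (simp only: fps_compose_add_distrib fps_compose_const_mult fps_X_power_compose [OF assms(1)])
  then show ?thesis by (simp add: power_add algebra_simps)
qed

text \<open>\<open>Z\<close> and \<open>v\<close> come from normalising the form A dx / h2;
  \<open>u\<close> and \<open>q\<close> are then forced by the conditions on x, and the condition on
  t2 follows from \<open>eq\<close>.\<close>

lemma equivalent_d_fam:
  fixes d :: "'k::{alg_closed_field, field_char_0} L"
  assumes lin: "lin d" and D: "coef d W1 = SF 0 0 0 A" "coef d W2 = SF 0 0 0 E" "coef d W3 = SF 0 h1 h2 0"
    and eq: "A * h1 + E * h2 + h1 * fps_deriv h2 - h2 * fps_deriv h1 = 0"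
    and dvd: "fps_X ^ m dvd A" "fps_X ^ (m + 1) dvd E" "fps_X ^ (m + 2) dvd h1" "fps_X ^ (m + 2) dvd h2"
    and A: "fps_nth A m = 1" and h2: "h2 \<noteq> 0"
  shows "\<exists>n>m. \<exists>a. equivalent d (d_fam m n a)"
proof -
  have sd: "m + 2 \<le> subdegree h2"
    by (rule subdegree_ge_dvd [OF h2 dvd(4)])
  define n p where "n = subdegree h2 - 1" and "p = n - m"
  have n: "subdegree h2 = n + 1" "m < n" "0 < p" "n = m + p" using sd by (auto simp: n_def p_def)
  have "fps_X ^ (n + 1) dvd h2" "fps_X ^ (n + 1) dvd h1"
    using extension_h1_dvd [OF eq dvd A h2] fps_X_power_dvd_subdegree [of "n + 1" h2]
    by (simp_all add: n(1) del: power_Suc)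
  then obtain \<gamma> \<eta> where \<gamma>: "h2 = fps_X ^ (n + 1) * \<gamma>" and \<eta>: "h1 = fps_X ^ (n + 1) * \<eta>"
    by (auto elim!: dvdE simp del: power_Suc)
  obtain \<alpha> where \<alpha>: "A = fps_X ^ m * \<alpha>" using dvd(1) by (rule dvdE)
  have \<alpha>0: "fps_nth \<alpha> 0 = 1" using A unfolding \<alpha> by (simp add: fps_X_power_mult_nth)
  have "fps_nth h2 (n + 1) \<noteq> 0" using h2 n(1) by (metis nth_subdegree_nonzero)
  then have \<gamma>0: "fps_nth \<gamma> 0 \<noteq> 0" unfolding \<gamma> fps_X_power_mult_nth by simp
  \<comment> \<open>A / h2 = k / x^(p+1), so \<open>k\<close> is the input for
    \<open>normalize_form\<close>.\<close>
  define k where "k = \<alpha> * inverse \<gamma>"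
  have \<gamma>k: "\<gamma> * k = \<alpha>"
  proof -
    have "\<gamma> * k = \<alpha> * (\<gamma> * inverse \<gamma>)" by (simp add: k_def algebra_simps)
    then show ?thesis using \<gamma>0 by (simp add: inverse_mult_eq_1')
  qed
  have k0: "fps_nth k 0 \<noteq> 0" using \<alpha>0 \<gamma>0 by (simp add: k_def)
  obtain l \<nu> a K where l0: "fps_nth l 0 \<noteq> 0" and dZ: "fps_deriv (fps_X * l) = K * l ^ (p + 1)"
    and K: "(1 + fps_const a * (fps_X * l) ^ p) * (k - fps_X ^ (p + 1) * \<nu>) = K"
    by (rule normalize_form [OF n(3) k0])
  obtain v where v0: "fps_nth v 0 \<noteq> 0" and dv: "fps_deriv v = \<nu> * v"
    by (rule log_derivative_exists)
  define Z \<omega> where "Z = fps_X * l" and "\<omega> = 1 + fps_const a * Z ^ p"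
  \<comment> \<open>\<open>w\<close> inverts the unit factor of \<open>\<beta>\<close> below, so
    that \<beta> u = h2 Z' and \<beta> q = h1 Z'.\<close>
  define w where "w = inverse (l ^ (n + 1) * \<omega>)"
  define u q where "u = \<gamma> * fps_deriv Z * w" and "q = \<eta> * fps_deriv Z * w"
  have Z0: "fps_nth Z 0 = 0" and Z1: "fps_nth Z 1 = fps_nth l 0" by (simp_all add: Z_def)
  have "fps_nth \<omega> 0 = 1" using n(3) Z0 by (simp add: \<omega>_def fps_power_zeroth)
  then have lw0: "fps_nth (l ^ (n + 1) * \<omega>) 0 \<noteq> 0" using l0 by (simp add: fps_power_zeroth)
  then have w: "l ^ (n + 1) * \<omega> * w = 1" unfolding w_def by (rule inverse_mult_eq_1')
  have "fps_nth (fps_deriv Z) 0 \<noteq> 0" using Z1 l0 by simp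
  then have u0: "fps_nth u 0 \<noteq> 0" using \<gamma>0 lw0 by (simp add: u_def w_def)
  define \<beta> where "\<beta> = fam_series m n a oo Z"
  have \<beta>: "\<beta> = fps_X ^ (n + 1) * (l ^ (n + 1) * \<omega>)"
    unfolding \<beta>_def fam_series_compose [OF Z0 n(2)] unfolding \<omega>_def Z_def p_def
    by (simp only: power_mult_distrib mult.assoc)
  have \<beta>_ne: "\<beta> \<noteq> 0"
  proof -
    have "l ^ (n + 1) * \<omega> \<noteq> 0" using lw0 by auto
    then show ?thesis unfolding \<beta> by simp
  qed
  have \<beta>u: "\<beta> * u = h2 * fps_deriv Z"
  proof -
    have "\<beta> * u = h2 * fps_deriv Z * (l ^ (n + 1) * \<omega> * w)" unfolding \<beta> u_def \<gamma> by (simp only: mult_ac)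
    then show ?thesis unfolding w by simp
  qed
  have \<beta>q: "\<beta> * q = h1 * fps_deriv Z"
  proof -
    have "\<beta> * q = h1 * fps_deriv Z * (l ^ (n + 1) * \<omega> * w)" unfolding \<beta> q_def \<eta> by (simp only: mult_ac)
    then show ?thesis unfolding w by simp
  qed
  have uq: "h1 * u = h2 * q" unfolding u_def q_def \<gamma> \<eta> by (simp only: mult_ac)
  \<comment> \<open>After x^m v is split off, the claim is \<gamma> (k - x^(p+1) \<nu>) = l^m u.
    This is the identity \<open>K\<close> multiplied by \<gamma> l^(p+1), with Z' = K l^(p+1)
    inserted.\<close>
  have main: "A * v - h2 * fps_deriv v = Z ^ m * v * u"
  proof -
    have "l ^ (p + 1) * \<omega> * (\<gamma> * (k - fps_X ^ (p + 1) * \<nu>)) = \<gamma> * fps_deriv Z"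
      unfolding Z_def dZ K [symmetric] \<omega>_def by (simp only: mult_ac)
    also have "\<dots> = \<gamma> * fps_deriv Z * (l ^ (n + 1) * \<omega> * w)" unfolding w by simp
    also have "\<dots> = l ^ (p + 1) * \<omega> * (l ^ m * u)"
    proof -
      have "l ^ (n + 1) = l ^ (p + 1) * l ^ m" by (simp add: n(4) power_add)
      then show ?thesis unfolding u_def by (simp only: mult_ac)
    qed
    finally have "l ^ (p + 1) * \<omega> * (\<gamma> * (k - fps_X ^ (p + 1) * \<nu>)) = l ^ (p + 1) * \<omega> * (l ^ m * u)" .
    moreover have "l ^ (p + 1) * \<omega> \<noteq> 0" using lw0 by auto
    ultimately have *: "\<gamma> * (k - fps_X ^ (p + 1) * \<nu>) = l ^ m * u" by (metis mult_left_cancel)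
    have X: "fps_X ^ (n + 1) = fps_X ^ m * (fps_X ^ (p + 1) :: 'k fps)" by (simp add: n(4) power_add)
    have "A * v - h2 * fps_deriv v = fps_X ^ m * v * (\<gamma> * (k - fps_X ^ (p + 1) * \<nu>))"
      unfolding \<alpha> \<gamma> dv X \<gamma>k [symmetric] by (simp only: right_diff_distrib left_diff_distrib mult_ac)
    also have "\<dots> = Z ^ m * v * u" unfolding * Z_def power_mult_distrib by (simp only: mult_ac)
    finally show ?thesis .
  qed
  \<comment> \<open>Multiplied by \<beta>, the expression becomes Z' times the left side of
    \<open>eq\<close> minus \<beta>' (h1 u - h2 q), and both vanish.\<close>
  have qu: "A * q + E * u + h1 * fps_deriv u - h2 * fps_deriv q = 0"
  proof -
    have "fps_deriv (\<beta> * u) = fps_deriv (h2 * fps_deriv Z)" "fps_deriv (\<beta> * q) = fps_deriv (h1 * fps_deriv Z)"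
      unfolding \<beta>u \<beta>q by (rule refl)+
    then have du: "\<beta> * fps_deriv u = fps_deriv h2 * fps_deriv Z + h2 * fps_deriv (fps_deriv Z) - fps_deriv \<beta> * u"
      and dq: "\<beta> * fps_deriv q = fps_deriv h1 * fps_deriv Z + h1 * fps_deriv (fps_deriv Z) - fps_deriv \<beta> * q"
      by (simp_all add: algebra_simps)
    have "\<beta> * (A * q + E * u + h1 * fps_deriv u - h2 * fps_deriv q)
        = A * (\<beta> * q) + E * (\<beta> * u) + h1 * (\<beta> * fps_deriv u) - h2 * (\<beta> * fps_deriv q)"
      by (simp add: algebra_simps)
    also have "\<dots> = fps_deriv Z * (A * h1 + E * h2 + h1 * fps_deriv h2 - h2 * fps_deriv h1)
        - fps_deriv \<beta> * (h1 * u - h2 * q)"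
      unfolding \<beta>u \<beta>q du dq by (simp add: algebra_simps)
    also have "\<dots> = 0" unfolding eq uq by simp
    finally show ?thesis using \<beta>_ne by simp
  qed
  have fam: "coef (d_fam m n a) W1 = SF 0 0 0 (fps_X ^ m)" "coef (d_fam m n a) W2 = SF 0 0 0 0"
    "coef (d_fam m n a) W3 = SF 0 0 (fam_series m n a) 0"
    by (simp_all add: coef_d_fam)
  have "equivalent d (d_fam m n a)"
  proof (rule equivalent_substI [OF lin lin_d_fam Z0 _ v0 u0])
    show "fps_nth Z 1 \<noteq> 0" using Z1 l0 by simp
    show "vf (coef d) (sf_subst Z v u q F) = sf_subst Z v u q (vf (coef (d_fam m n a)) F)" for F
      by (rule vf_sf_subst [OF D fam Z0]) (use \<beta>u \<beta>q main qu uq in \<open>simp_all only: \<beta>_def\<close>)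
  qed
  then show ?thesis using n(2) by blast
qed

lemma extension_classification:
  fixes d :: "'k::{alg_closed_field, field_char_0} L"
  assumes "is_extension (m + 2) (d_inf m) d"
  shows "equivalent d (d_inf m) \<or> (\<exists>n>m. \<exists>a. equivalent d (d_fam m n a))"
proof -
  have lin: "lin d" using assms by (simp add: is_extension_def codifferential_def)
  obtain A E h1 h2 where D: "coef d W1 = SF 0 0 0 A" "coef d W2 = SF 0 0 0 E" "coef d W3 = SF 0 h1 h2 0"
    and eq: "A * h1 + E * h2 + h1 * fps_deriv h2 - h2 * fps_deriv h1 = 0"
    and dvd: "fps_X ^ m dvd A" "fps_X ^ (m + 1) dvd E" "fps_X ^ (m + 2) dvd h1" "fps_X ^ (m + 2) dvd h2"
    and A: "fps_nth A m = 1"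
    by (rule extension_normal_shape [OF assms]) blast
  show ?thesis
  proof (cases "h2 = 0")
    case True
    have "A \<noteq> 0" using A by auto
    then have "h1 = 0" using eq True by simp
    then show ?thesis using equivalent_d_inf [OF lin D(1,2) _ dvd(1,2) A] D(3) True by simp
  next
    case False
    then show ?thesis using equivalent_d_fam [OF lin D eq dvd A] by blast
  qed
qed

section \<open>Nonequivalence\<close>

lemma fps_X_power_cancel:
  fixes f g :: "'k::field fps"
  assumes "fps_X ^ i * f = fps_X ^ j * g" "fps_nth f 0 \<noteq> 0" "fps_nth g 0 \<noteq> 0"
  shows "i = j" "f = g"
proof -
  have "fps_nth (fps_X ^ i * f) i \<noteq> 0" "fps_nth (fps_X ^ j * g) j \<noteq> 0"
    using assms(2,3) by (simp_all add: fps_X_power_mult_nth)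
  then have "\<not> i < j" "\<not> j < i"
    using assms(1) by (metis fps_X_power_mult_nth)+
  then show "i = j" by simp
  with assms(1) show "f = g" by simp
qed

text \<open>
  The two hypotheses express the invariance of the form \<open>x\<^sup>m dx / fam_series m n a\<close> up to a logarithmic
  derivative.  The residue is read off as the coefficient of \<open>x\<^sup>p\<close>, where the exact part
  \<open>M = p \<kappa> - x \<kappa>'\<close> does not contribute.
\<close>

lemma fam_parameters_unique:
  fixes X y t :: "'k::field_char_0 fps"
  assumes X: "fps_nth X 0 = 0" "fps_nth X 1 \<noteq> 0" and y: "fps_nth y 0 \<noteq> 0" and t: "fps_nth t 0 \<noteq> 0"
    and n: "m < n" "m < n'"
    and 1: "(fam_series m n a oo X) * t = fam_series m n' a' * fps_deriv X"
    and 2: "X ^ m * y * t = fps_X ^ m * y - fam_series m n' a' * fps_deriv y"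
  shows "n = n' \<and> a = a'"
proof -
  obtain \<xi> where \<xi>: "X = fps_X * \<xi>"
    using X(1) fps_X_power_dvd_iff [of 1 X] by (auto elim: dvdE)
  have \<xi>0: "fps_nth \<xi> 0 \<noteq> 0" using X(2) by (simp add: \<xi>)
  define p where "p = n - m"
  have p: "0 < p" "n + 1 = m + (p + 1)" using n by (auto simp: p_def)
  define \<omega> where "\<omega> = 1 + fps_X ^ p * (fps_const a * \<xi> ^ p)"
  define \<omega>' where "\<omega>' = 1 + fps_X ^ (n' - m) * fps_const a'"
  have B: "fam_series m n a oo X = fps_X ^ (n + 1) * (\<xi> ^ (n + 1) * \<omega>)"
    unfolding fam_series_compose [OF X(1) n(1)] unfolding \<omega>_def \<xi> p_def
    by (simp only: power_mult_distrib mult.assoc mult.left_commute [of "fps_const a"])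
  have B': "fam_series m n' a' = fps_X ^ (n' + 1) * \<omega>'"
  proof -
    have "2 * n' - m + 1 = (n' + 1) + (n' - m)" using n(2) by simp
    then show ?thesis unfolding fam_series_def \<omega>'_def
      by (simp only: power_add distrib_left mult_ac mult_1_right mult_1_left)
  qed
  have dX: "fps_deriv X = \<xi> + fps_X * fps_deriv \<xi>" by (simp add: \<xi> algebra_simps)
  have \<omega>0: "fps_nth \<omega> 0 = 1" "fps_nth \<omega>' 0 = 1"
    using p(1) n(2) by (simp_all add: \<omega>_def \<omega>'_def fps_X_power_mult_nth)
  \<comment> \<open>Both sides are a power of x times a unit; comparing exponents gives n =
    n'.\<close>
  have "fps_X ^ (n + 1) * (\<xi> ^ (n + 1) * \<omega> * t) = fps_X ^ (n' + 1) * (\<omega>' * fps_deriv X)"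
    using 1 unfolding B B' by (simp only: mult.assoc)
  moreover have "fps_nth (\<xi> ^ (n + 1) * \<omega> * t) 0 \<noteq> 0" "fps_nth (\<omega>' * fps_deriv X) 0 \<noteq> 0"
    using \<xi>0 \<omega>0 t X(2) by (simp_all add: fps_power_zeroth)
  ultimately have nn: "n + 1 = n' + 1" and e1: "\<xi> ^ (n + 1) * \<omega> * t = \<omega>' * fps_deriv X"
    using fps_X_power_cancel by blast+
  then have nn': "n = n'" by simp
  have yi: "y * inverse y = 1" using y by (rule inverse_mult_eq_1')
  \<comment> \<open>The second hypothesis divided by x^m y.\<close>
  have e2: "\<xi> ^ m * t = 1 - fps_X ^ (p + 1) * (\<omega>' * fps_deriv y * inverse y)"
  proof -
    have "fps_X ^ m * (\<xi> ^ m * (y * t)) = fps_X ^ m * (y - fps_X ^ (p + 1) * (\<omega>' * fps_deriv y))"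
      using 2 unfolding B' unfolding nn' [symmetric] p(2) \<xi> by (simp only: power_mult_distrib power_add right_diff_distrib mult_ac)
    then have "\<xi> ^ m * (y * t) = y - fps_X ^ (p + 1) * (\<omega>' * fps_deriv y)"
      by (rule mult_left_cancel [THEN iffD1, rotated]) simp
    then have "\<xi> ^ m * (y * t) * inverse y = (y - fps_X ^ (p + 1) * (\<omega>' * fps_deriv y)) * inverse y" by simp
    moreover have "\<xi> ^ m * (y * t) * inverse y = \<xi> ^ m * t * (y * inverse y)" by (simp only: mult_ac)
    moreover have "(y - fps_X ^ (p + 1) * (\<omega>' * fps_deriv y)) * inverse y
        = y * inverse y - fps_X ^ (p + 1) * (\<omega>' * fps_deriv y * inverse y)"
      by (simp only: left_diff_distrib mult.assoc)
    ultimately show ?thesis unfolding yi by simp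
  qed
  define \<nu> where "\<nu> = \<omega>' * fps_deriv y * inverse y"
  \<comment> \<open>\<kappa> x^(-p) = X^(-p) has derivative -x^(-p-1) M. A derivative has no
    residue, which appears as the vanishing of M at order p in \<open>M_nth\<close>.\<close>
  define \<kappa> where "\<kappa> = inverse \<xi> ^ p"
  have \<kappa>\<xi>: "\<kappa> * \<xi> ^ p = 1"
    using inverse_mult_eq_1 [OF \<xi>0] by (simp add: \<kappa>_def flip: power_mult_distrib)
  define M where "M = fps_const (of_nat p) * \<kappa> - fps_X * fps_deriv \<kappa>"
  have M_nth: "fps_nth M i = (of_nat p - of_nat i) * fps_nth \<kappa> i" for i
    by (cases i) (simp_all add: M_def algebra_simps)
  have M: "\<xi> ^ (p + 1) * M = fps_const (of_nat p) * fps_deriv X"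
  proof -
    have "\<xi> ^ (p + 1) * M = fps_const (of_nat p) * ((\<kappa> * \<xi> ^ p) * \<xi>) - fps_X * (fps_deriv \<kappa> * \<xi> ^ (p + 1))"
      by (simp add: M_def algebra_simps)
    then show ?thesis
      unfolding \<kappa>\<xi> fps_deriv_inverse_power [OF p(1) \<kappa>\<xi>] dX by (simp add: algebra_simps)
  qed
  \<comment> \<open>Eliminates \<open>t\<close> between \<open>e1\<close> and
    \<open>e2\<close>.\<close>
  have "\<xi> ^ (p + 1) * (fps_const (of_nat p) * (\<omega> * (1 - fps_X ^ (p + 1) * \<nu>)))
      = fps_const (of_nat p) * (\<xi> ^ (n + 1) * \<omega> * t)"
    unfolding \<nu>_def e2 [symmetric] p(2) power_add [of \<xi> m] by (simp only: mult_ac)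
  also have "\<dots> = \<xi> ^ (p + 1) * (\<omega>' * M)"
    unfolding e1 using M by (metis mult.left_commute)
  finally have eq: "fps_const (of_nat p) * (\<omega> * (1 - fps_X ^ (p + 1) * \<nu>)) = \<omega>' * M"
    using \<xi>0 by (auto simp del: power_Suc)
  have L: "fps_const (of_nat p) * (\<omega> * (1 - fps_X ^ (p + 1) * \<nu>))
      = fps_const (of_nat p) * (1 + fps_X ^ p * (fps_const a * \<xi> ^ p) - fps_X ^ (p + 1) * (\<omega> * \<nu>))"
    unfolding \<omega>_def by (simp only: algebra_simps mult_1_left mult_1_right)
  have R: "\<omega>' * M = M + fps_X ^ p * (fps_const a' * M)"
    unfolding \<omega>'_def nn' [symmetric] p_def [symmetric] by (simp add: algebra_simps)
  have p0: "of_nat p \<noteq> (0 :: 'k)" using p(1) by simp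
  \<comment> \<open>The constant coefficients give \<kappa>(0) = 1, hence \<xi>(0)^p = 1. The
    coefficients of x^p read p a \<xi>(0)^p = p a' \<kappa>(0), which then means a = a'.\<close>
  have c0: "fps_nth (fps_const (of_nat p) * (\<omega> * (1 - fps_X ^ (p + 1) * \<nu>))) 0 = of_nat p"
    unfolding L using p(1) by (simp add: fps_X_power_mult_nth del: power_Suc)
  have "fps_nth (\<omega>' * M) 0 = of_nat p * fps_nth \<kappa> 0"
    using \<omega>0 by (simp add: M_nth)
  then have \<kappa>0: "fps_nth \<kappa> 0 = 1" using c0 p0 unfolding eq by simp
  have "fps_nth (\<kappa> * \<xi> ^ p) 0 = 1" unfolding \<kappa>\<xi> by simp
  then have \<xi>p: "fps_nth (\<xi> ^ p) 0 = 1" by (simp add: \<kappa>0)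
  have "fps_nth (fps_const (of_nat p) * (\<omega> * (1 - fps_X ^ (p + 1) * \<nu>))) p = of_nat p * a"
    unfolding L using p(1) \<xi>p by (simp add: fps_X_power_mult_nth del: power_Suc)
  moreover have "fps_nth (\<omega>' * M) p = of_nat p * a'"
    unfolding R by (simp add: fps_X_power_mult_nth M_nth \<kappa>0)
  ultimately have "of_nat p * a = of_nat p * a'" unfolding eq by auto
  then show ?thesis using p0 nn' by simp
qed

section \<open>The transpose of an arbitrary coalgebra automorphism\<close>

definition pullback :: "('k::field_char_0 S \<Rightarrow> 'k S) \<Rightarrow> 'k sf \<Rightarrow> 'k sf" where
  "pullback g F = sf_of (\<lambda>I. ev (cf F) (g (vec I)))"

lemma c00_pullback [simp]: "fps_nth (c00 (pullback g F)) 0 = 0"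
  by (simp add: pullback_def)

lemma ev_pullback: "lin g \<Longrightarrow> ev (cf (pullback g F)) x = ev (cf F) (g x)"
  by (simp add: pullback_def ev_lin [of g _ x])

lemma ev_cf_sf_add: "ev (cf (sf_add F H)) x = ev (cf F) x + ev (cf H) x"
proof -
  have "cf (sf_add F H) = (\<lambda>I. cf F I + cf H I)" by (rule ext) simp
  then show ?thesis by (simp add: ev_functional_add)
qed

lemma ev_cf_sf_scale: "ev (cf (sf_scale r F)) x = r * ev (cf F) x"
proof -
  have "cf (sf_scale r F) = (\<lambda>I. r * cf F I)" by (rule ext) simp
  then show ?thesis by simp
qed

lemma pullback_add: "pullback g (sf_add F H) = sf_add (pullback g F) (pullback g H)"
proof (rule cf_eqI)
  show "cf (pullback g (sf_add F H)) = cf (sf_add (pullback g F) (pullback g H))"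
    by (simp add: pullback_def fun_eq_iff ev_cf_sf_add)
qed (cases "pullback g F"; cases "pullback g H"; use c00_pullback [of g F] c00_pullback [of g H] in simp)

lemma pullback_scale: "pullback g (sf_scale r F) = sf_scale r (pullback g F)"
proof (rule cf_eqI)
  show "cf (pullback g (sf_scale r F)) = cf (sf_scale r (pullback g F))"
    by (simp add: pullback_def fun_eq_iff ev_cf_sf_scale)
qed (cases "pullback g F"; use c00_pullback [of g F] in simp)

lemma c00_sf_mult: "fps_nth (c00 (sf_mult F H)) 0 = fps_nth (c00 F) 0 * fps_nth (c00 H) 0"
  by (cases F; cases H) simp

text \<open>By \<open>ev_comult\<close>, applied before and after \<open>g\<close>, compatibility
  with \<open>comult\<close> becomes multiplicativity.\<close>

lemma pullback_mult:
  assumes "coalg_automorphism g" "fps_nth (c00 F) 0 = 0" "fps_nth (c00 H) 0 = 0"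
  shows "pullback g (sf_mult F H) = sf_mult (pullback g F) (pullback g H)"
proof (rule cf_eqI, rule ext)
  fix I
  have lin: "lin g" and com: "comult (g (vec I)) = tensor_map g g (comult (vec I))"
    using assms(1) by (auto simp: coalg_automorphism_def)
  have "cf (pullback g (sf_mult F H)) I = ev (cf (sf_mult F H)) (g (vec I))"
    by (simp add: pullback_def)
  also have "\<dots> = ev (\<lambda>p. cf F (fst p) * cf H (snd p)) (tensor_map g g (comult (vec I)))"
    unfolding ev_comult [OF assms(2,3), symmetric] com ..
  also have "\<dots> = ev (\<lambda>p. cf (pullback g F) (fst p) * cf (pullback g H) (snd p)) (comult (vec I))"
    unfolding ev_tensor_map by (simp add: pullback_def)
  also have "\<dots> = cf (sf_mult (pullback g F) (pullback g H)) I"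
    unfolding ev_comult [OF c00_pullback c00_pullback] by simp
  finally show "cf (pullback g (sf_mult F H)) I = cf (sf_mult (pullback g F) (pullback g H)) I" .
qed (simp add: c00_sf_mult)

text \<open>Transposing \<open>g \<circ> coder d' = coder d \<circ> g\<close> reverses the order:
  the field of \<open>d'\<close> acts after the pullback, that of \<open>d\<close> before
  it.\<close>

lemma pullback_vf:
  assumes g: "coalg_automorphism g" and d: "lin d" "lin d'"
    and eq: "coder d' = Hilbert_Choice.inv g \<circ> coder d \<circ> g"
  shows "vf (coef d') (pullback g F) = pullback g (vf (coef d) F)"
proof (rule cf_eqI, rule ext)
  fix I
  have lin: "lin g" and "bij g" using g by (auto simp: coalg_automorphism_def)
  then have "g (coder d' (vec I)) = coder d (g (vec I))"
    by (simp add: eq surj_f_inv_f bij_is_surj)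
  then have "ev (cf (pullback g F)) (coder d' (vec I)) = ev (cf F) (coder d (g (vec I)))"
    by (simp add: ev_pullback lin)
  then show "cf (vf (coef d') (pullback g F)) I = cf (pullback g (vf (coef d) F)) I"
    by (simp add: ev_coder d) (simp add: pullback_def)
qed (simp add: c00_vf)

lemma cf_parity:
  assumes "c10 F = 0" "c01 F = 0" "mpar I = 1"
  shows "cf F I = 0"
  using assms by (cases I rule: mindex_cases) (auto simp: cf_def)

lemma cf_parity':
  assumes "c00 F = 0" "c11 F = 0" "mpar I = 0"
  shows "cf F I = 0"
  using assms by (cases I rule: mindex_cases) (auto simp: cf_def)

lemma automorphism_parity:
  assumes "coalg_automorphism g" "mpar J \<noteq> mpar I"
  shows "Poly_Mapping.lookup (g (vec I)) J = 0"
proof -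
  have "lin g" "has_parity mpar mpar 0 g" using assms(1) by (auto simp: coalg_automorphism_def)
  then show ?thesis using assms(2) has_parity_iff [of g mpar mpar 0] by (metis add_0)
qed

lemma pullback_even:
  assumes "coalg_automorphism g" "c10 F = 0" "c01 F = 0"
  obtains f f12 where "pullback g F = SF f 0 0 f12" "fps_nth f 0 = 0"
proof -
  have "ev (cf F) (g (vec I)) = 0" if "mpar I = 1" for I
    unfolding ev_def
  proof (rule sum.neutral, rule ballI)
    fix J
    show "Poly_Mapping.lookup (g (vec I)) J * cf F J = 0"
      using that cf_parity [OF assms(2,3), of J] automorphism_parity [OF assms(1), of J I]
      by (cases "mpar J = mpar I") simp_all
  qed
  then have "c10 (pullback g F) = 0" "c01 (pullback g F) = 0"
    by (simp_all add: pullback_def sf_of_def fps_eq_iff)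
  then show ?thesis using that [of "c00 (pullback g F)" "c11 (pullback g F)"] c00_pullback
    by (simp add: sf.expand)
qed

lemma pullback_odd:
  assumes "coalg_automorphism g" "c00 F = 0" "c11 F = 0"
  obtains f1 f2 where "pullback g F = SF 0 f1 f2 0"
proof -
  have *: "ev (cf F) (g (vec I)) = 0" if "mpar I = 0" for I
    unfolding ev_def
  proof (rule sum.neutral, rule ballI)
    fix J
    show "Poly_Mapping.lookup (g (vec I)) J * cf F J = 0"
      using that cf_parity' [OF assms(2,3), of J] automorphism_parity [OF assms(1), of J I]
      by (cases "mpar J = mpar I") simp_all
  qed
  have "mpar (MI (0, 0, n)) = 0" if "0 < n" for n
    using that by (cases n) simp_all
  moreover have "mpar (MI (1, 1, n)) = 0" for n by simp
  ultimately have "c00 (pullback g F) = 0" "c11 (pullback g F) = 0"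
    using * by (simp_all add: pullback_def sf_of_def fps_eq_iff)
  then show ?thesis using that [of "c10 (pullback g F)" "c01 (pullback g F)"]
    by (simp add: sf.expand)
qed

text \<open>
  Every monomial functional of degree at least two is a product, so primitive elements are linear.
\<close>

lemma lookup_primitive:
  fixes y :: "'k::field_char_0 S"
  assumes "comult y = 0" "2 \<le> mdeg J"
  shows "Poly_Mapping.lookup y J = 0"
proof -
  have prod: "ev (cf (sf_mult F H)) y = 0" if "fps_nth (c00 F) 0 = 0" "fps_nth (c00 H) 0 = 0" for F H :: "'k sf"
    using ev_comult [OF that, of y] assms(1) by simp
  have coeff: "Poly_Mapping.lookup y J = 0"
    if "cf (sf_mult F H) = (\<lambda>I. r * (if I = J then 1 else 0))" "r \<noteq> 0"
      "fps_nth (c00 F) 0 = 0" "fps_nth (c00 H) 0 = 0" for F H :: "'k sf" and r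
    using prod [OF that(3,4)] that(2) unfolding that(1) by (simp add: lookup_eq_ev)
  have eq: "cf (sf_mult F H) = (\<lambda>I. r * (if I = J then 1 else 0))"
    if "\<And>I. cf (sf_mult F H) I = r * (if I = J then 1 else 0)" for F H :: "'k sf" and r
    using that by (rule ext)
  show ?thesis
  \<comment> \<open>The monomials are split as x times x^n, x times x^n' t1, x times x^n' t2 and t1
    times x^n t2. Degree at least two makes both factors vanish at the origin.\<close>
  proof (cases J rule: mindex_cases)
    case (even0 n)
    with assms(2) obtain n' where n: "n = Suc n'" by (cases n) auto
    show ?thesis
    proof (rule coeff [OF eq])
      fix I show "cf (sf_mult (SF fps_X 0 0 0) (SF (fps_X ^ n) 0 0 0)) I = fact (Suc n) * (if I = J then 1 else (0::'k))"
        unfolding even0 by (cases I rule: mindex_cases) (simp_all add: cf_def MI_eq_iff fps_X_power_nth del: fact_Suc flip: power_Suc)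
    qed (simp_all add: n del: fact_Suc)
  next
    case (W1 n)
    with assms(2) obtain n' where n: "n = Suc n'" by (cases n) auto
    show ?thesis
    proof (rule coeff [OF eq])
      fix I show "cf (sf_mult (SF fps_X 0 0 0) (SF 0 (fps_X ^ n') 0 0)) I = fact n * (if I = J then 1 else (0::'k))"
        unfolding W1 n by (cases I rule: mindex_cases) (simp_all add: cf_def MI_eq_iff fps_X_power_nth del: fact_Suc flip: power_Suc)
    qed simp_all
  next
    case (W2 n)
    with assms(2) obtain n' where n: "n = Suc n'" by (cases n) auto
    show ?thesis
    proof (rule coeff [OF eq])
      fix I show "cf (sf_mult (SF fps_X 0 0 0) (SF 0 0 (fps_X ^ n') 0)) I = fact n * (if I = J then 1 else (0::'k))"
        unfolding W2 n by (cases I rule: mindex_cases) (simp_all add: cf_def MI_eq_iff fps_X_power_nth del: fact_Suc flip: power_Suc)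
    qed simp_all
  next
    case (both n)
    show ?thesis
    proof (rule coeff [OF eq])
      fix I show "cf (sf_mult (SF 0 1 0 0) (SF 0 0 (fps_X ^ n) 0)) I = fact n * (if I = J then 1 else (0::'k))"
        unfolding both by (cases I rule: mindex_cases) (simp_all add: cf_def MI_eq_iff fps_X_power_nth del: fact_Suc)
    qed simp_all
  qed
qed

text \<open>A one-letter word has empty coproduct, so \<open>g\<close> maps generators to primitive
  elements.\<close>

lemma automorphism_generator:
  assumes "coalg_automorphism g" "2 \<le> mdeg J"
  shows "Poly_Mapping.lookup (g (vec (gmono j))) J = (0 :: 'k::field_char_0)"
proof (rule lookup_primitive [OF _ assms(2)])
  have "length (mword (gmono j)) = 1" by (cases j) (simp_all add: mword_def exps_MI)
  then have "comult (vec (gmono j) :: 'k S) = 0"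
    by (simp add: comult_def comult_word_def Let_def)
  moreover have "tensor_map g g 0 = 0" by (simp add: tensor_map_def lin_ext_def)
  ultimately show "comult (g (vec (gmono j))) = 0"
    using assms(1) by (simp add: coalg_automorphism_def)
qed

lemma ev_coordinates:
  fixes y :: "'k::field_char_0 S"
  shows "ev (cf (SF fps_X 0 0 0)) y = Poly_Mapping.lookup y (MI (0, 0, 1))"
    and "ev (cf (SF 0 1 0 0)) y = Poly_Mapping.lookup y (MI (1, 0, 0))"
    and "ev (cf (SF 0 0 1 0)) y = Poly_Mapping.lookup y (MI (0, 1, 0))"
proof -
  have "cf (SF fps_X 0 0 0 :: 'k sf) I = (if I = MI (0, 0, 1) then 1 else 0)"
    "cf (SF 0 1 0 0 :: 'k sf) I = (if I = MI (1, 0, 0) then 1 else 0)"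
    "cf (SF 0 0 1 0 :: 'k sf) I = (if I = MI (0, 1, 0) then 1 else 0)" for I
    by (cases I rule: mindex_cases; simp add: cf_def MI_eq_iff)+
  then have "cf (SF fps_X 0 0 0 :: 'k sf) = (\<lambda>I. if I = MI (0, 0, 1) then 1 else 0)"
    "cf (SF 0 1 0 0 :: 'k sf) = (\<lambda>I. if I = MI (1, 0, 0) then 1 else 0)"
    "cf (SF 0 0 1 0 :: 'k sf) = (\<lambda>I. if I = MI (0, 1, 0) then 1 else 0)"
    by blast+
  then show "ev (cf (SF fps_X 0 0 0)) y = Poly_Mapping.lookup y (MI (0, 0, 1))"
    "ev (cf (SF 0 1 0 0)) y = Poly_Mapping.lookup y (MI (1, 0, 0))"
    "ev (cf (SF 0 0 1 0)) y = Poly_Mapping.lookup y (MI (0, 1, 0))"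
    by (simp_all only: lookup_eq_ev)
qed

text \<open>Parity gives the shapes. The rest is injectivity of \<open>g\<close> on
  \<open>W\<close>, which it maps to itself: the even part is \<open>fps_nth X 1\<close>, and the
  odd part is the matrix of constant terms of \<open>p11\<close>, \<open>p12\<close>,
  \<open>p21\<close>, \<open>p22\<close>, triangular once \<open>p21 = 0\<close>.\<close>

lemma pullback_coordinates:
  fixes g :: "'k::field_char_0 S \<Rightarrow> 'k S"
  assumes g: "coalg_automorphism g"
  obtains X Y p11 p12 p21 p22 where
    "pullback g (SF fps_X 0 0 0) = SF X 0 0 Y" "fps_nth X 0 = 0" "fps_nth X 1 \<noteq> 0"
    "pullback g (SF 0 1 0 0) = SF 0 p11 p12 0" "pullback g (SF 0 0 1 0) = SF 0 p21 p22 0"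
    "p21 = 0 \<longrightarrow> fps_nth p11 0 \<noteq> 0 \<and> fps_nth p22 0 \<noteq> 0"
proof -
  have lin: "lin g" and "inj g" using g by (auto simp: coalg_automorphism_def bij_is_inj)
  have nz: "g (vec I) \<noteq> 0" for I
  proof
    assume "g (vec I) = 0"
    then have "g (vec I) = g 0" by (simp add: lin_zero lin)
    then have "vec I = (0 :: 'k S)" using \<open>inj g\<close> by (simp add: inj_eq)
    then have "Poly_Mapping.lookup (vec I :: 'k S) I = 0" by simp
    then show False by simp
  qed
  obtain X Y where X: "pullback g (SF fps_X 0 0 0) = SF X 0 0 Y" "fps_nth X 0 = 0"
    by (rule pullback_even [OF g, of "SF fps_X 0 0 0"]) auto
  obtain p11 p12 where p1: "pullback g (SF 0 1 0 0) = SF 0 p11 p12 0"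
    by (rule pullback_odd [OF g, of "SF 0 1 0 0"]) auto
  obtain p21 p22 where p2: "pullback g (SF 0 0 1 0) = SF 0 p21 p22 0"
    by (rule pullback_odd [OF g, of "SF 0 0 1 0"]) auto
  have cfG: "cf (pullback g F) I = ev (cf F) (g (vec I))" for F I
    by (simp add: pullback_def)
  have deg: "Poly_Mapping.lookup (g (vec (gmono j))) J = 0" if "2 \<le> mdeg J" for J j
    using automorphism_generator [OF g that] .
  have par: "Poly_Mapping.lookup (g (vec I)) J = 0" if "mpar J \<noteq> mpar I" for I J
    using automorphism_parity [OF g that] .
  have X1: "fps_nth X 1 \<noteq> 0"
  proof
    assume "fps_nth X 1 = 0"
    then have z: "Poly_Mapping.lookup (g (vec (MI (0, 0, 1)))) (MI (0, 0, 1)) = 0"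
      using cfG [of "SF fps_X 0 0 0" "MI (0, 0, 1)"] unfolding X ev_coordinates by (simp add: cf_def)
    have "g (vec (MI (0, 0, 1))) = 0"
    proof (rule poly_mapping_eqI)
      fix J show "Poly_Mapping.lookup (g (vec (MI (0, 0, 1)))) J = Poly_Mapping.lookup 0 J"
      proof (cases J rule: mindex_cases)
        case (even0 n)
        then show ?thesis using z deg [of J W3] by (cases n) simp_all
      next
        case (both n)
        then show ?thesis using deg [of J W3] by simp
      qed (simp_all add: par)
    qed
    then show False using nz by blast
  qed
  have "fps_nth p11 0 \<noteq> 0 \<and> fps_nth p22 0 \<noteq> 0" if "p21 = 0"
  proof -
    define \<alpha> \<beta> \<delta> where "\<alpha> = fps_nth p11 0" and "\<beta> = fps_nth p12 0" and "\<delta> = fps_nth p22 0"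
    have l1: "Poly_Mapping.lookup (g (vec (MI (1, 0, 0)))) (MI (1, 0, 0)) = \<alpha>"
      "Poly_Mapping.lookup (g (vec (MI (0, 1, 0)))) (MI (1, 0, 0)) = \<beta>"
      using cfG [of "SF 0 1 0 0" "MI (1, 0, 0)"] cfG [of "SF 0 1 0 0" "MI (0, 1, 0)"]
      unfolding p1 ev_coordinates by (simp_all add: cf_def \<alpha>_def \<beta>_def)
    have l2: "Poly_Mapping.lookup (g (vec (MI (1, 0, 0)))) (MI (0, 1, 0)) = 0"
      "Poly_Mapping.lookup (g (vec (MI (0, 1, 0)))) (MI (0, 1, 0)) = \<delta>"
      using cfG [of "SF 0 0 1 0" "MI (1, 0, 0)"] cfG [of "SF 0 0 1 0" "MI (0, 1, 0)"] that
      unfolding p2 ev_coordinates by (simp_all add: cf_def \<delta>_def)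
    have g1: "g (vec (MI (1, 0, 0))) = \<alpha> *\<^sub>v vec (MI (1, 0, 0))"
    proof (rule poly_mapping_eqI)
      fix J show "Poly_Mapping.lookup (g (vec (MI (1, 0, 0)))) J = Poly_Mapping.lookup (\<alpha> *\<^sub>v vec (MI (1, 0, 0))) J"
      proof (cases J rule: mindex_cases)
        case (W1 n)
        then show ?thesis using l1 deg [of J W1] by (cases n) (simp_all add: lookup_single MI_inject)
      next
        case (W2 n)
        then show ?thesis using l2 deg [of J W1] by (cases n) (simp_all add: lookup_single MI_inject)
      qed (simp_all add: par lookup_single MI_inject)
    qed
    have g2: "g (vec (MI (0, 1, 0))) = \<beta> *\<^sub>v vec (MI (1, 0, 0)) + \<delta> *\<^sub>v vec (MI (0, 1, 0))"
    proof (rule poly_mapping_eqI)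
      fix J show "Poly_Mapping.lookup (g (vec (MI (0, 1, 0)))) J =
          Poly_Mapping.lookup (\<beta> *\<^sub>v vec (MI (1, 0, 0)) + \<delta> *\<^sub>v vec (MI (0, 1, 0))) J"
      proof (cases J rule: mindex_cases)
        case (W1 n)
        then show ?thesis using l1 deg [of J W2] by (cases n) (simp_all add: lookup_add lookup_single MI_inject)
      next
        case (W2 n)
        then show ?thesis using l2 deg [of J W2] by (cases n) (simp_all add: lookup_add lookup_single MI_inject)
      qed (simp_all add: par lookup_add lookup_single MI_inject)
    qed
    have "\<alpha> \<noteq> 0" using g1 nz [of "MI (1, 0, 0)"] by auto
    \<comment> \<open>Otherwise \<alpha> w2 and \<beta> w1 would have the same image.\<close>
    moreover have "\<delta> \<noteq> 0"
    proof
      assume "\<delta> = 0"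
      then have "g (\<alpha> *\<^sub>v vec (MI (0, 1, 0))) = \<alpha> *\<^sub>v (\<beta> *\<^sub>v vec (MI (1, 0, 0)))"
        using lin g2 by (simp add: lin_iff)
      also have "\<dots> = \<beta> *\<^sub>v (\<alpha> *\<^sub>v vec (MI (1, 0, 0)))"
        by (rule poly_mapping_eqI) simp
      also have "\<dots> = g (\<beta> *\<^sub>v vec (MI (1, 0, 0)))"
        unfolding g1 [symmetric] using lin by (simp only: lin_iff)
      finally have "\<alpha> *\<^sub>v vec (MI (0, 1, 0)) = \<beta> *\<^sub>v (vec (MI (1, 0, 0)) :: 'k S)"
        using \<open>inj g\<close> by (simp only: inj_eq)
      then have "Poly_Mapping.lookup (\<alpha> *\<^sub>v vec (MI (0, 1, 0))) (MI (0, 1, 0)) =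
          Poly_Mapping.lookup (\<beta> *\<^sub>v (vec (MI (1, 0, 0)) :: 'k S)) (MI (0, 1, 0))" by (rule arg_cong)
      then show False using \<open>\<alpha> \<noteq> 0\<close> by (simp add: lookup_single MI_inject)
    qed
    ultimately show ?thesis by (simp add: \<alpha>_def \<delta>_def)
  qed
  with X X1 p1 p2 that show ?thesis by blast
qed

text \<open>\<open>pullback\<close> sends the constant 1 to 0, so powers of x are treated together
  with a further factor, odd or a multiple of t1 t2, on which the induction can start.\<close>

lemma pullback_X_power_mult:
  fixes p q r f1 f2 f12 :: "'k::field_char_0 fps"
  assumes g: "coalg_automorphism g" and X: "pullback g (SF fps_X 0 0 0) = SF X 0 0 Y"
  shows "pullback g (SF 0 f1 f2 0) = SF 0 p q 0 \<Longrightarrow>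
      pullback g (SF 0 (fps_X ^ k * f1) (fps_X ^ k * f2) 0) = SF 0 (X ^ k * p) (X ^ k * q) 0"
    and "pullback g (SF 0 0 0 f12) = SF 0 0 0 r \<Longrightarrow>
      pullback g (SF 0 0 0 (fps_X ^ k * f12)) = SF 0 0 0 (X ^ k * r)"
proof (induction k)
  case (Suc k)
  {
    case 1
    then show ?case
      using pullback_mult [OF g, of "SF fps_X 0 0 0" "SF 0 (fps_X ^ k * f1) (fps_X ^ k * f2) 0"] Suc.IH(1)
      by (simp add: X mult.assoc)
  next
    case 2
    then show ?case
      using pullback_mult [OF g, of "SF fps_X 0 0 0" "SF 0 0 0 (fps_X ^ k * f12)"] Suc.IH(2)
      by (simp add: X mult.assoc)
  }
qed simp_all

text \<open>\<open>d_inf\<close> annihilates x, so \<open>d_fam\<close> would annihilate its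
  pullback; but the t2 component of the result is \<open>fam_series m n a * fps_deriv X\<close>,
  which is not 0.\<close>

lemma fam_not_equivalent_d_inf:
  fixes a :: "'k::field_char_0"
  assumes "m < n"
  shows "\<not> equivalent (d_inf m) (d_fam m n a)"
proof
  assume "equivalent (d_inf m) (d_fam m n a)"
  then obtain g where g: "coalg_automorphism g"
    and eq: "coder (d_fam m n a) = Hilbert_Choice.inv g \<circ> coder (d_inf m) \<circ> g"
    unfolding equivalent_def by blast
  obtain X Y where X: "pullback g (SF fps_X 0 0 0) = SF X 0 0 Y" "fps_nth X 1 \<noteq> 0"
    by (rule pullback_coordinates [OF g])
  have inf: "coef (d_inf m :: 'k L) W1 = SF 0 0 0 (fps_X ^ m)" "coef (d_inf m :: 'k L) W2 = SF 0 0 0 0"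
    "coef (d_inf m :: 'k L) W3 = SF 0 0 0 0"
    by (simp_all add: coef_d_inf)
  have fam: "coef (d_fam m n a) W1 = SF 0 0 0 (fps_X ^ m)" "coef (d_fam m n a) W2 = SF 0 0 0 0"
    "coef (d_fam m n a) W3 = SF 0 0 (fam_series m n a) 0"
    by (simp_all add: coef_d_fam)
  have "pullback g (SF 0 0 0 0) = SF 0 0 0 0"
    using pullback_scale [of g 0 "SF 0 0 0 0"] by (cases "pullback g (SF 0 0 0 0)") simp
  then have "fam_series m n a * fps_deriv X = 0"
    using pullback_vf [OF g lin_d_inf lin_d_fam eq, of "SF fps_X 0 0 0"]
    unfolding X vf_odd [OF inf] vf_odd [OF fam] by simp
  then have "fam_series m n a = 0 \<or> fps_deriv X = 0" by simp
  moreover have "fps_nth (fam_series m n a) (n + 1) \<noteq> 0"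
    using assms by (simp add: fam_series_def fps_X_power_nth del: power_Suc)
  moreover have "fps_nth (fps_deriv X) 0 \<noteq> 0" using X(2) by simp
  ultimately show False by (metis fps_zero_nth)
qed

text \<open>On x, the intertwining relation gives B p21 = 0, hence p21 = 0, and the first relation
  of \<open>fam_parameters_unique\<close> with t = p22; on t1 it gives the second with y =
  p11.\<close>

lemma fam_equivalent_unique:
  fixes a a' :: "'k::field_char_0"
  assumes n: "m < n" "m < n'" and "equivalent (d_fam m n a) (d_fam m n' a')"
  shows "n = n' \<and> a = a'"
proof -
  obtain g where g: "coalg_automorphism g"
    and eq: "coder (d_fam m n' a') = Hilbert_Choice.inv g \<circ> coder (d_fam m n a) \<circ> g"
    using assms(3) unfolding equivalent_def by blast
  obtain X Y p11 p12 p21 p22 where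
    X: "pullback g (SF fps_X 0 0 0) = SF X 0 0 Y" "fps_nth X 0 = 0" "fps_nth X 1 \<noteq> 0"
    and p: "pullback g (SF 0 1 0 0) = SF 0 p11 p12 0" "pullback g (SF 0 0 1 0) = SF 0 p21 p22 0"
    and unit: "p21 = 0 \<longrightarrow> fps_nth p11 0 \<noteq> 0 \<and> fps_nth p22 0 \<noteq> 0"
    by (rule pullback_coordinates [OF g]) blast
  have fam: "coef (d_fam m k b) W1 = SF 0 0 0 (fps_X ^ m)" "coef (d_fam m k b) W2 = SF 0 0 0 0"
    "coef (d_fam m k b) W3 = SF 0 0 (fam_series m k b) 0" for k and b :: 'k
    by (simp_all add: coef_d_fam)
  note vf = pullback_vf [OF g lin_d_fam lin_d_fam eq]
  define B where "B = fam_series m n a oo X"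
  have GB: "pullback g (SF 0 0 (fam_series m n a) 0) = SF 0 (B * p21) (B * p22) 0"
  proof -
    have s: "SF 0 0 (fam_series m n a) 0 =
        sf_add (SF 0 0 (fps_X ^ (n + 1)) 0) (sf_scale a (SF 0 0 (fps_X ^ (2 * n - m + 1)) 0))"
      by (simp add: fam_series_def)
    have G: "pullback g (SF 0 0 (fps_X ^ k) 0) = SF 0 (X ^ k * p21) (X ^ k * p22) 0" for k
      using pullback_X_power_mult(1) [OF g X(1) p(2), of k] by simp
    have "B = X ^ (n + 1) + fps_const a * X ^ (2 * n - m + 1)"
      unfolding B_def fam_series_def
      by (simp only: fps_compose_add_distrib fps_compose_const_mult fps_X_power_compose [OF X(2)])
    then show ?thesis
      unfolding s pullback_add pullback_scale G by (simp add: algebra_simps)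
  qed
  have G12: "pullback g (SF 0 0 0 (fps_X ^ m)) = SF 0 0 0 (X ^ m * (p11 * p22 - p12 * p21))"
  proof -
    have "pullback g (SF 0 0 0 1) = SF 0 0 0 (p11 * p22 - p12 * p21)"
      using pullback_mult [OF g, of "SF 0 1 0 0" "SF 0 0 1 0"] by (simp add: p)
    from pullback_X_power_mult(2) [OF g X(1) this, of m] show ?thesis by simp
  qed
  have "SF 0 0 (fam_series m n' a' * fps_deriv X) 0 = SF 0 (B * p21) (B * p22) 0"
    using vf [of "SF fps_X 0 0 0"] unfolding X(1) vf_odd [OF fam] by (simp add: GB)
  then have 1: "B * p21 = 0" "B * p22 = fam_series m n' a' * fps_deriv X" by simp_all
  have "B \<noteq> 0"
  proof -
    have "fps_nth (1 + fps_const a * X ^ (n - m)) 0 \<noteq> 0"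
      using n(1) X(2) by (simp add: fps_power_zeroth zero_power)
    then have "1 + fps_const a * X ^ (n - m) \<noteq> 0" by fastforce
    moreover have "X \<noteq> 0" using X(3) by auto
    ultimately show ?thesis unfolding B_def fam_series_compose [OF X(2) n(1)] by simp
  qed
  with 1(1) have p21: "p21 = 0" by simp
  have "SF 0 0 0 (fps_X ^ m * p11 - fam_series m n' a' * fps_deriv p11)
      = SF 0 0 0 (X ^ m * (p11 * p22 - p12 * p21))"
    using vf [of "SF 0 1 0 0"] unfolding p(1) vf_odd [OF fam] by (simp add: G12)
  then have 2: "X ^ m * p11 * p22 = fps_X ^ m * p11 - fam_series m n' a' * fps_deriv p11"
    by (simp add: p21 mult.assoc)
  show ?thesis
    using fam_parameters_unique [OF X(2,3) _ _ n _ 2] unit p21 1(2) unfolding B_def by blast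
qed

theorem mainTheorem5:
  fixes m :: nat
  shows
    "(\<forall>n>m. \<forall>a::'k::{alg_closed_field, field_char_0}.
        is_extension (m + 2) (d_inf m) (d_fam m n a)) \<and>
     (\<forall>d::'k L. is_extension (m + 2) (d_inf m) d \<longrightarrow>
        equivalent d (d_inf m) \<or> (\<exists>n>m. \<exists>a. equivalent d (d_fam m n a))) \<and>
     (\<forall>n>m. \<forall>a::'k. \<not> equivalent (d_inf m) (d_fam m n a)) \<and>
     (\<forall>n>m. \<forall>n'>m. \<forall>a a'::'k. (n, a) \<noteq> (n', a') \<longrightarrow>
        \<not> equivalent (d_fam m n a) (d_fam m n' a'))"
proof (intro conjI allI impI notI)
  show "is_extension (m + 2) (d_inf m) (d_fam m n a)" if "m < n" for n and a :: 'k
    by (rule is_extension_d_fam [OF that])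
  show "equivalent d (d_inf m) \<or> (\<exists>n>m. \<exists>a. equivalent d (d_fam m n a))"
    if "is_extension (m + 2) (d_inf m) d" for d :: "'k L"
    by (rule extension_classification [OF that])
  show False if "m < n" "equivalent (d_inf m) (d_fam m n a)" for n and a :: 'k
    using fam_not_equivalent_d_inf that by blast
  show False if "m < n" "m < n'" "(n, a) \<noteq> (n', a')" "equivalent (d_fam m n a) (d_fam m n' a')"
    for n n' and a a' :: 'k
    using fam_equivalent_unique [OF that(1,2,4)] that(3) by simp
qed

end
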